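(* Let $G$ be a finite simple graph with vertex set $V_G=\{x_1,\ldots,x_n\}$ and edge set $E_G$, let $k$ be a field, and let $R=k[x_1,\ldots,x_n]$. Set $J=I(G)^{\vee}$ and let \[L=\prod_{1\le i_1<i_2<i_3<i_4\le n}(x_{i_1}+x_{i_2}+x_{i_3}+x_{i_4})\in R.\] Then the following are equivalent: (a) $G$ has no odd hole. (b) $J^2:(L)=J^2$. (c) $\operatorname{adeg}(J^2)=3|E_G|+t(G)$, where $\operatorname{adeg}(J^2)$ denotes the arithmetic degree of $J^2$ and $t(G)$ is the number of triangles of $G$.
   Context: The vertices of $G$ are identified with the variables of $R$. The edge ideal of $G$ is $I(G)=(x_ix_j \mid \{x_i,x_j\}\in E_G)\subset R$. The Alexander dual of a square-free monomial ideal $I=(x_{1,1}\cdots x_{1,t_1},\ldots,x_{r,1}\cdots x_{r,t_r})$ (given by its minimal generators) is $I^{\vee}=(x_{1,1},\ldots,x_{1,t_1})\cap\cdots\cap(x_{r,1},\ldots,x_{r,t_r})$; thus $I(G)^{\vee}=\bigcap_{\{x_i,x_j\}\in E_G}(x_i,x_j)$ (an empty intersection is $R$; an empty product is $1$). An induced cycle of $G$ is a cycle without chords, i.e. a set of vertices whose induced subgraph is exactly a cycle. An odd hole of $G$ is an induced cycle of odd length at least five. A triangle is a 3-cycle. For a homogeneous ideal $I$ of $R$, the arithmetic degree is $\operatorname{adeg}(I)=\sum_{P}\operatorname{mult}_I(P)\deg(P)$, the sum over all homogeneous prime ideals $P\subseteq R$, where $\operatorname{mult}_I(P)$ is the length of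 the largest ideal of finite length in the ring $R_P/IR_P$ and $\deg(P)$ is the degree of $R/P$. One has $\operatorname{mult}_I(P)>0$ iff $P\in\operatorname{Ass}(R/I)$; when $I$ is a monomial ideal all associated primes are generated by variables and have degree $1$, so $\operatorname{adeg}(I)=\sum_{P\in\operatorname{Ass}(R/I)}\operatorname{mult}_I(P)$. *)

theory Defs
  imports
    "HOL-Library.Poly_Mapping"
    "HOL-Library.Extended_Nat"
    "HOL-Computational_Algebra.Polynomial"
    "HOL-Computational_Algebra.Fraction_Field"
    "HOL-Algebra.Ideal_Product"
    "HOL-Algebra.QuotRing"
    "HOL-Algebra.Embedded_Algebras"
begin

section \<open>Graphs\<close>

definition simple_graph :: "'v set \<Rightarrow> 'v set set \<Rightarrow> bool" where
  "simple_graph V E \<longleftrightarrow> finite V \<and> (\<forall>e\<in>E. e \<subseteq> V \<and> card e = 2)"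

text \<open>The vertex set \<open>S\<close> can be enumerated cyclically as \<open>c 0, \<dots>, c (m - 1)\<close>, \<open>m \<ge> 3\<close>, in such a
  way that the edges of the subgraph induced on \<open>S\<close> are exactly the edges of that cycle.\<close>

definition induced_cycle :: "'v set \<Rightarrow> 'v set set \<Rightarrow> 'v set \<Rightarrow> bool" where
  "induced_cycle V E S \<longleftrightarrow> S \<subseteq> V \<and>
     (\<exists>m c. m \<ge> 3 \<and> bij_betw c {..<m} S \<and>
        {e \<in> E. e \<subseteq> S} = {{c i, c (Suc i mod m)} | i. i < m})"

definition odd_hole :: "'v set \<Rightarrow> 'v set set \<Rightarrow> 'v set \<Rightarrow> bool" where
  "odd_hole V E S \<longleftrightarrow> induced_cycle V E S \<and> odd (card S) \<and> card S \<ge> 5"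

text \<open>A 3-cycle cannot have a chord, so every 3-cycle is induced.\<close>

definition num_triangles :: "'v set \<Rightarrow> 'v set set \<Rightarrow> nat" where
  "num_triangles V E = card {S. induced_cycle V E S \<and> card S = 3}"


section \<open>The polynomial ring in the variables \<open>x\<^sub>1, \<dots>, x\<^sub>n\<close>\<close>

text \<open>An element of \<open>nat \<Rightarrow>\<^sub>0 nat\<close> is the exponent vector of a monomial in variables indexed by
  \<open>nat\<close>; the ring \<open>k[x\<^sub>1, \<dots>, x\<^sub>n]\<close> is the subring of those polynomials which only involve variables
  with index in \<open>{1..n}\<close>.\<close>

type_synonym 'k mpoly = "(nat \<Rightarrow>\<^sub>0 nat) \<Rightarrow>\<^sub>0 'k"

definition poly_ring :: "nat \<Rightarrow> 'k::field mpoly ring" where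
  "poly_ring n =
     \<lparr> carrier = {f. \<forall>u \<in> Poly_Mapping.keys f. Poly_Mapping.keys u \<subseteq> {1..n}},
       mult = (*), one = 1, zero = 0, add = (+) \<rparr>"

definition monomial :: "(nat \<Rightarrow>\<^sub>0 nat) \<Rightarrow> 'k::field mpoly" where
  "monomial u = Poly_Mapping.single u 1"

definition var :: "nat \<Rightarrow> 'k::field mpoly" where
  "var i = monomial (Poly_Mapping.single i 1)"

definition total_degree :: "(nat \<Rightarrow>\<^sub>0 nat) \<Rightarrow> nat" where
  "total_degree u = (\<Sum>i \<in> Poly_Mapping.keys u. Poly_Mapping.lookup u i)"

definition homogeneous_part :: "nat \<Rightarrow> nat \<Rightarrow> 'k::field mpoly set" where
  "homogeneous_part n d = {f \<in> carrier (poly_ring n). \<forall>u \<in> Poly_Mapping.keys f. total_degree u = d}"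

definition homogeneous_ideal :: "nat \<Rightarrow> 'k::field mpoly set \<Rightarrow> bool" where
  "homogeneous_ideal n I \<longleftrightarrow> ideal I (poly_ring n) \<and>
     I = Idl\<^bsub>poly_ring n\<^esub> {f \<in> I. \<exists>d. f \<in> homogeneous_part n d}"


section \<open>Edge ideals and Alexander duals\<close>

definition edge_ideal :: "nat \<Rightarrow> nat set set \<Rightarrow> 'k::field mpoly set" where
  "edge_ideal n E = Idl\<^bsub>poly_ring n\<^esub> {var i * var j | i j. {i, j} \<in> E}"

text \<open>The exponents of the minimal monomial generators of a monomial ideal, that is, of the
  monomials in the ideal that are minimal with respect to divisibility.\<close>

definition minimal_generators :: "'k::field mpoly set \<Rightarrow> (nat \<Rightarrow>\<^sub>0 nat) set" where
  "minimal_generators I =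
     {u. monomial u \<in> I \<and> (\<forall>v. monomial v \<in> I \<and> (\<exists>w. u = v + w) \<longrightarrow> v = u)}"

text \<open>Intended for square-free monomial ideals. Intersecting with the carrier makes the empty
  intersection the whole ring.\<close>

definition alexander_dual :: "nat \<Rightarrow> 'k::field mpoly set \<Rightarrow> 'k mpoly set" where
  "alexander_dual n I =
     carrier (poly_ring n) \<inter> (\<Inter>u \<in> minimal_generators I. Idl\<^bsub>poly_ring n\<^esub> (var ` Poly_Mapping.keys u))"


section \<open>Colon ideals, localization, length\<close>

definition ideal_colon :: "('a, 'm) ring_scheme \<Rightarrow> 'a set \<Rightarrow> 'a set \<Rightarrow> 'a set" where
  "ideal_colon R I K = {r \<in> carrier R. \<forall>a \<in> K. r \<otimes>\<^bsub>R\<^esub> a \<in> I}"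

text \<open>The localization of \<open>R\<close> at the prime ideal \<open>P\<close>, for a subring \<open>R\<close> of an integral domain whose
  operations are those of the ambient type, as a subring of the fraction field.\<close>

definition localization :: "('a::idom, 'm) ring_scheme \<Rightarrow> 'a set \<Rightarrow> 'a fract ring" where
  "localization R P =
     \<lparr> carrier = {Fract a s | a s. a \<in> carrier R \<and> s \<in> carrier R - P},
       mult = (*), one = 1, zero = 0, add = (+) \<rparr>"

text \<open>The ring \<open>R\<^sub>P / I R\<^sub>P\<close>.\<close>

definition local_quotient ::
    "('a::idom, 'm) ring_scheme \<Rightarrow> 'a set \<Rightarrow> 'a set \<Rightarrow> 'a fract set ring" where
  "local_quotient R I P =
     localization R P Quot (Idl\<^bsub>localization R P\<^esub> ((\<lambda>a. Fract a 1) ` I))"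

text \<open>The length of an ideal \<open>N\<close> of \<open>A\<close> as an \<open>A\<close>-module: the submodules of \<open>N\<close> are the ideals of
  \<open>A\<close> contained in \<open>N\<close>, and the length is the supremum of the lengths of strict chains of those.\<close>

definition ideal_length :: "('a, 'm) ring_scheme \<Rightarrow> 'a set \<Rightarrow> enat" where
  "ideal_length A N =
     (SUP l \<in> {l. \<exists>c. (\<forall>i\<le>l. ideal (c i) A \<and> c i \<subseteq> N) \<and> (\<forall>i<l. c i \<subset> c (Suc i))}. enat l)"

definition largest_finite_length_ideal :: "('a, 'm) ring_scheme \<Rightarrow> 'a set" where
  "largest_finite_length_ideal A =
     (THE N. ideal N A \<and> ideal_length A N < \<infinity> \<and>
        (\<forall>N'. ideal N' A \<and> ideal_length A N' < \<infinity> \<longrightarrow> N' \<subseteq> N))"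


section \<open>Arithmetic degree\<close>

text \<open>The multiplicity of \<open>P\<close> in \<open>I\<close>.\<close>

definition mult_at :: "nat \<Rightarrow> 'k::field mpoly set \<Rightarrow> 'k mpoly set \<Rightarrow> nat" where
  "mult_at n I P =
     (let A = local_quotient (poly_ring n) I P
      in the_enat (ideal_length A (largest_finite_length_ideal A)))"

text \<open>The \<open>k\<close>-dimension of the degree-\<open>d\<close> component of \<open>R / I\<close>, for a proper homogeneous ideal \<open>I\<close>:
  the field \<open>k\<close> and the component of \<open>R\<close> of degree \<open>d\<close> are mapped into the quotient ring.\<close>

definition hilbert_function :: "nat \<Rightarrow> 'k::field mpoly set \<Rightarrow> nat \<Rightarrow> nat" where
  "hilbert_function n I d =
     (let \<pi> = (\<lambda>f. I +>\<^bsub>poly_ring n\<^esub> f)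
      in ring.dim (poly_ring n Quot I) (\<pi> ` range (Poly_Mapping.single 0)) (\<pi> ` homogeneous_part n d))"

definition hilbert_polynomial :: "nat \<Rightarrow> 'k::field mpoly set \<Rightarrow> rat poly" where
  "hilbert_polynomial n I =
     (THE h. \<forall>\<^sub>F d in sequentially. poly h (of_nat d) = of_nat (hilbert_function n I d))"

text \<open>The degree (multiplicity) of the graded ring \<open>R / I\<close>. If its Krull dimension \<open>r\<close> is positive,
  the Hilbert polynomial has degree \<open>r - 1\<close>, and the degree is \<open>(r - 1)!\<close> times its leading
  coefficient. In Krull dimension \<open>0\<close> the Hilbert polynomial vanishes, and the degree is the vector
  space dimension of \<open>R / I\<close>.\<close>

definition degree_of_quotient :: "nat \<Rightarrow> 'k::field mpoly set \<Rightarrow> rat" where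
  "degree_of_quotient n I =
     (let h = hilbert_polynomial n I
      in if h = 0 then of_nat (\<Sum>d | hilbert_function n I d \<noteq> 0. hilbert_function n I d)
         else fact (Polynomial.degree h) * Polynomial.lead_coeff h)"

text \<open>The sum over all homogeneous primes; since only finitely many of them have nonzero
  multiplicity, the remaining ones are left out of the index set.\<close>

definition adeg :: "nat \<Rightarrow> 'k::field mpoly set \<Rightarrow> rat" where
  "adeg n I =
     (\<Sum>P | primeideal P (poly_ring n) \<and> homogeneous_ideal n P \<and> mult_at n I P \<noteq> 0.
        of_nat (mult_at n I P) * degree_of_quotient n P)"

end

theory Submission
  imports Defs
begin

text \<open>The proof rests on an explicit primary decomposition of \<open>J\<^sup>2\<close>. The ideal \<open>J\<close> is spanned by the monomials whose
exponent vectors cover all edges, and \<open>x\<^sup>u\<close> lies in \<open>J\<^sup>2\<close> iff \<open>u\<close> is a sum of two covers. This happens iff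
\<open>u\<^sub>i + u\<^sub>j \<ge> 2\<close> for every edge and the vertices with \<open>u\<^sub>i = 1\<close> induce a bipartite graph
(\<open>two_covers_iff\<close>). A graph is bipartite iff it has no odd induced cycle, so \<open>J\<^sup>2\<close> is the intersection
of the squares \<open>(x\<^sub>i, x\<^sub>j)\<^sup>2\<close> over the edges \<open>{i, j}\<close> and of the ideals \<open>(x\<^sub>i\<^sup>2 | i \<in> C)\<close>,
where \<open>C\<close> runs over the odd induced cycles, triangles included. Each component is primary to the ideal generated by its
variables (\<open>mono_ideal_primary\<close>).

For the colon ideal, \<open>L\<close> lies in a prime generated by variables iff there are at least four of them. Without odd holes
all radicals of components have two or three variables, so \<open>L\<close> is not a zero divisor modulo \<open>J\<^sup>2\<close>. An odd hole has at
least five vertices, so its prime, which is associated to \<open>J\<^sup>2\<close>, contains \<open>L\<close>.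

For the arithmetic degree, the decomposition also gives all multiplicities. In the localization at a prime \<open>P\<close> only the
components with radical inside \<open>P\<close> survive (\<open>sat_Q\<close>), and an ideal of finite length lies in all components whose radical
is strictly smaller than \<open>P\<close>, since its elements are killed by powers of every element of \<open>P\<close>. Hence the multiplicity is zero
unless \<open>P\<close> is the radical of a component. At an edge the local ring modulo the square of its maximal ideal has
length \<open>3\<close>. At an odd induced cycle \<open>C\<close>, the monomials in the components of the edges of \<open>C\<close> but not in that of \<open>C\<close> have
exponent \<open>1\<close> on all of \<open>C\<close>, so the multiplicity is \<open>1\<close>. A quotient by variables has degree \<open>1\<close>. Therefore
the arithmetic degree of \<open>J\<^sup>2\<close> is three times the number of edges plus the number of odd induced cycles; this
exceeds three times the number of edges plus the number of triangles by the number of odd holes.\<close>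

section \<open>Subrings of a commutative ring\<close>

text \<open>The polynomial ring and its localizations, as records, both inherit their operations from the
ambient type. For such rings ideals can be described with the operators of the type classes, so that
the simplifier can be used for the arithmetic.\<close>

definition ambient_subring :: "'a::comm_ring_1 set \<Rightarrow> 'a ring" where
  "ambient_subring C = \<lparr> carrier = C, mult = (*), one = 1, zero = 0, add = (+) \<rparr>"

lemma ambient_subring_simps [simp]:
  "carrier (ambient_subring C) = C" "mult (ambient_subring C) = (*)" "one (ambient_subring C) = 1"
  "zero (ambient_subring C) = 0" "add (ambient_subring C) = (+)"
  by (simp_all add: ambient_subring_def)

lemma cring_ambient_subring:
  assumes "1 \<in> C" and "\<And>x y. x \<in> C \<Longrightarrow> y \<in> C \<Longrightarrow> x + y \<in> C"
    and "\<And>x. x \<in> C \<Longrightarrow> - x \<in> C" and "\<And>x y. x \<in> C \<Longrightarrow> y \<in> C \<Longrightarrow> x * y \<in> C"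
  shows "cring (ambient_subring C)"
proof (rule cringI)
  have "0 \<in> C"
    using assms(2)[OF assms(1) assms(3)[OF assms(1)]] by simp
  then show "abelian_group (ambient_subring C)"
    by (intro abelian_groupI) (auto intro: assms bexI[where x = "- _"] simp: algebra_simps)
  show "Group.comm_monoid (ambient_subring C)"
    by (rule comm_monoidI) (auto intro: assms simp: algebra_simps)
qed (auto simp: algebra_simps)

lemma uminus_in_ambient_subring:
  assumes "cring (ambient_subring C)" "x \<in> C"
  shows "- x \<in> C" "\<ominus>\<^bsub>ambient_subring C\<^esub> x = - x"
proof -
  interpret cring "ambient_subring C" by fact
  have "x + \<ominus>\<^bsub>ambient_subring C\<^esub> x = 0"
    using r_neg[of x] assms(2) by simp
  then show eq: "\<ominus>\<^bsub>ambient_subring C\<^esub> x = - x"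
    by (simp add: eq_neg_iff_add_eq_0 add.commute)
  show "- x \<in> C"
    using a_inv_closed[of x] assms(2) eq by simp
qed

lemma ambient_subring_closed:
  assumes "cring (ambient_subring C)"
  shows "1 \<in> C" "0 \<in> C" "x \<in> C \<Longrightarrow> y \<in> C \<Longrightarrow> x + y \<in> C" "x \<in> C \<Longrightarrow> - x \<in> C"
    "x \<in> C \<Longrightarrow> y \<in> C \<Longrightarrow> x - y \<in> C" "x \<in> C \<Longrightarrow> y \<in> C \<Longrightarrow> x * y \<in> C" "x \<in> C \<Longrightarrow> x ^ k \<in> C"
proof -
  interpret cring "ambient_subring C" by fact
  show 1: "1 \<in> C" using one_closed by simp
  show "0 \<in> C" using zero_closed by simp
  show add: "x + y \<in> C" if "x \<in> C" "y \<in> C" for x y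
    using a_closed[of x y] that by simp
  show neg: "- x \<in> C" if "x \<in> C" for x
    by (rule uminus_in_ambient_subring[OF assms that])
  show "x - y \<in> C" if "x \<in> C" "y \<in> C"
    using add[OF that(1) neg[OF that(2)]] by simp
  show mult: "x * y \<in> C" if "x \<in> C" "y \<in> C" for x y
    using m_closed[of x y] that by simp
  show "x ^ k \<in> C" if "x \<in> C"
    by (induction k) (auto intro: 1 mult that)
qed

lemma ideal_ambient_subring_iff:
  assumes "cring (ambient_subring C)"
  shows "ideal I (ambient_subring C) \<longleftrightarrow>
    I \<subseteq> C \<and> 0 \<in> I \<and> (\<forall>a\<in>I. \<forall>b\<in>I. a + b \<in> I) \<and> (\<forall>r\<in>C. \<forall>a\<in>I. r * a \<in> I)"
proof
  assume "ideal I (ambient_subring C)"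
  then interpret ideal I "ambient_subring C" .
  show "I \<subseteq> C \<and> 0 \<in> I \<and> (\<forall>a\<in>I. \<forall>b\<in>I. a + b \<in> I) \<and> (\<forall>r\<in>C. \<forall>a\<in>I. r * a \<in> I)"
    using a_subset additive_subgroup.zero_closed[OF is_additive_subgroup]
      additive_subgroup.a_closed[OF is_additive_subgroup] I_l_closed
    by simp
next
  assume I: "I \<subseteq> C \<and> 0 \<in> I \<and> (\<forall>a\<in>I. \<forall>b\<in>I. a + b \<in> I) \<and> (\<forall>r\<in>C. \<forall>a\<in>I. r * a \<in> I)"
  interpret cring "ambient_subring C" by fact
  have neg: "- a \<in> I" if "a \<in> I" for a
  proof -
    have "(- 1) * a \<in> I"
      using I that ambient_subring_closed(1,4)[OF assms] by blast
    then show ?thesis by simp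
  qed
  show "ideal I (ambient_subring C)"
  proof (rule idealI)
    show "ring (ambient_subring C)" by (rule ring_axioms)
    show "subgroup I (add_monoid (ambient_subring C))"
    proof
      show "inv\<^bsub>add_monoid (ambient_subring C)\<^esub> x \<in> I" if "x \<in> I" for x
        using neg[OF that] uminus_in_ambient_subring(2)[OF assms, of x] I that
        by (auto simp: a_inv_def)
    qed (use I in auto)
    show "a \<otimes>\<^bsub>ambient_subring C\<^esub> x \<in> I" "x \<otimes>\<^bsub>ambient_subring C\<^esub> a \<in> I"
      if "a \<in> I" "x \<in> carrier (ambient_subring C)" for a x
      using I that by (simp_all add: mult.commute[of a x])
  qed
qed

lemma ideal_ambient_subringD:
  assumes "cring (ambient_subring C)" "ideal I (ambient_subring C)"
  shows "I \<subseteq> C" "0 \<in> I" "a \<in> I \<Longrightarrow> b \<in> I \<Longrightarrow> a + b \<in> I" "a \<in> I \<Longrightarrow> b \<in> I \<Longrightarrow> a - b \<in> I"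
    "r \<in> C \<Longrightarrow> a \<in> I \<Longrightarrow> r * a \<in> I" "r \<in> C \<Longrightarrow> a \<in> I \<Longrightarrow> a * r \<in> I"
proof -
  note * = assms(2)[unfolded ideal_ambient_subring_iff[OF assms(1)]]
  show "I \<subseteq> C" "0 \<in> I" "a \<in> I \<Longrightarrow> b \<in> I \<Longrightarrow> a + b \<in> I"
    "r \<in> C \<Longrightarrow> a \<in> I \<Longrightarrow> r * a \<in> I" "r \<in> C \<Longrightarrow> a \<in> I \<Longrightarrow> a * r \<in> I"
    using * by (auto simp: mult.commute)
  show "a - b \<in> I" if "a \<in> I" "b \<in> I"
  proof -
    have "(- 1) * b \<in> I"
      using * that ambient_subring_closed(1,4)[OF assms(1)] by blast
    then have "a + (- 1) * b \<in> I" using * that(1) by blast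
    then show ?thesis by simp
  qed
qed

section \<open>Lengths of ideals\<close>

text \<open>A cyclic filtration \<open>M 0 = 0, \<dots>, M r\<close> whose factors are simple or zero bounds all chains: an ideal \<open>N\<close>
inside \<open>M r\<close> is recorded by the set \<open>T N\<close> of steps \<open>l\<close> at which it contains an element of \<open>M (l + 1)\<close>
outside \<open>M l\<close>. If \<open>N \<subseteq> N'\<close> have the same steps, then \<open>N = N'\<close>, because an element of \<open>N'\<close> in
\<open>M (l + 1)\<close> can be moved into \<open>M l\<close> by subtracting a multiple of an element of \<open>N\<close>. So \<open>card (T N)\<close>
increases along every strict chain.\<close>

lemma (in cring) filtration_bounds_chains:
  fixes M :: "nat \<Rightarrow> 'a set" and c :: "nat \<Rightarrow> 'a set"
  assumes M0: "M 0 = {\<zero>}" and M: "\<And>l. l \<le> r \<Longrightarrow> ideal (M l) R"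
    and gen: "\<And>l x. l < r \<Longrightarrow> x \<in> M (Suc l) \<Longrightarrow> \<exists>u\<in>carrier R. \<exists>m\<in>M l. x = u \<otimes> g l \<oplus> m"
    and g: "\<And>l. l < r \<Longrightarrow> g l \<in> carrier R"
    and unit: "\<And>l u. l < r \<Longrightarrow> u \<in> carrier R \<Longrightarrow> u \<in> Units R \<or> u \<otimes> g l \<in> M l"
    and c: "\<And>i. i \<le> k \<Longrightarrow> ideal (c i) R \<and> c i \<subseteq> M r" and strict: "\<And>i. i < k \<Longrightarrow> c i \<subset> c (Suc i)"
  shows "k \<le> r"
proof -
  define T where "T N = {l. l < r \<and> (\<exists>x\<in>N \<inter> M (Suc l). x \<notin> M l)}" for N
  have eq: "N' \<subseteq> N" if N: "ideal N R" "ideal N' R" "N \<subseteq> N'" "N' \<subseteq> M r" "T N = T N'" for N N'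
  proof -
    have "N' \<inter> M l \<subseteq> N" if "l \<le> r" for l
      using that
    proof (induction l)
      case 0
      then show ?case
        using M0 N(1) by (auto simp: additive_subgroup.zero_closed ideal.axioms(1))
    next
      case (Suc l)
      have l: "l < r" using Suc.prems by simp
      interpret Ml: ideal "M l" R using M l by simp
      interpret N: ideal N R by fact
      interpret N': ideal N' R by fact
      show ?case
      proof
        fix y assume y: "y \<in> N' \<inter> M (Suc l)"
        show "y \<in> N"
        proof (cases "y \<in> M l")
          case True
          then show ?thesis using Suc y by auto
        next
          case False
          then have "l \<in> T N'" using y l by (auto simp: T_def)
          then obtain z where z: "z \<in> N" "z \<in> M (Suc l)" "z \<notin> M l"
            using N(5) by (auto simp: T_def)
          obtain u m where um: "u \<in> carrier R" "m \<in> M l" "z = u \<otimes> g l \<oplus> m"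
            using gen[OF l z(2)] by blast
          obtain v m' where vm: "v \<in> carrier R" "m' \<in> M l" "y = v \<otimes> g l \<oplus> m'"
            using gen[OF l] y by blast
          have "u \<otimes> g l \<notin> M l"
            using z(3) um Ml.a_closed by auto
          then have u: "u \<in> Units R" using unit[OF l um(1)] by blast
          \<comment> \<open>Modulo \<open>M l\<close>, \<open>z\<close> is a unit multiple of \<open>g l\<close>, hence \<open>y - w z\<close> falls into \<open>M l\<close> for this \<open>w\<close>.\<close>
          define w where "w = v \<otimes> inv u"
          have w: "w \<in> carrier R" using u vm by (simp add: w_def)
          have wu: "w \<otimes> u = v" using u vm um by (simp add: w_def m_assoc)
          note cl = um(1) vm(1) w g[OF l] Ml.Icarr[OF um(2)] Ml.Icarr[OF vm(2)]
          have "w \<otimes> z = w \<otimes> u \<otimes> g l \<oplus> w \<otimes> m"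
            using cl by (simp add: um(3) r_distr m_assoc)
          then have wz: "w \<otimes> z = v \<otimes> g l \<oplus> w \<otimes> m" by (simp add: wu)
          have "y \<ominus> w \<otimes> z = m' \<ominus> w \<otimes> m"
            unfolding wz vm(3) using cl by algebra
          moreover have "m' \<ominus> w \<otimes> m \<in> M l"
            using Ml.I_l_closed[OF um(2) w] vm(2) by (simp add: minus_eq Ml.a_closed Ml.a_inv_closed)
          moreover have "w \<otimes> z \<in> N" using N.I_l_closed[OF z(1) w] .
          moreover have "y \<ominus> w \<otimes> z \<in> N'"
            using calculation(3) N(3) y by (auto simp: minus_eq intro!: N'.a_closed N'.a_inv_closed)
          ultimately have "y \<ominus> w \<otimes> z \<in> N" using Suc l by auto
          then have "(y \<ominus> w \<otimes> z) \<oplus> w \<otimes> z \<in> N"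
            using \<open>w \<otimes> z \<in> N\<close> by (rule additive_subgroup.a_closed[OF N.is_additive_subgroup])
          moreover have "(y \<ominus> w \<otimes> z) \<oplus> w \<otimes> z = y"
          proof -
            have "y \<in> carrier R" "w \<otimes> z \<in> carrier R"
              using N'.Icarr N.Icarr[OF \<open>w \<otimes> z \<in> N\<close>] y by auto
            then show ?thesis by algebra
          qed
          ultimately show ?thesis by simp
        qed
      qed
    qed
    from this[of r] show ?thesis using N(4) by auto
  qed
  have fin: "finite (T N)" for N by (auto simp: T_def)
  have step: "card (T (c i)) < card (T (c (Suc i)))" if "i < k" for i
  proof (rule psubset_card_mono[OF fin])
    have "T (c i) \<subseteq> T (c (Suc i))"
      using strict[OF that] by (auto simp: T_def)
    moreover have "T (c i) \<noteq> T (c (Suc i))"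
      using eq[of "c i" "c (Suc i)"] c[of i] c[of "Suc i"] strict[OF that] that by auto
    ultimately show "T (c i) \<subset> T (c (Suc i))" by blast
  qed
  have "i \<le> card (T (c i))" if "i \<le> k" for i
    using that
  proof (induction i)
    case (Suc i)
    then show ?case using step[of i] by simp
  qed simp
  from this[of k] have "k \<le> card (T (c k))" by simp
  also have "\<dots> \<le> card {..<r}" by (rule card_mono) (auto simp: T_def)
  finally show ?thesis by simp
qed

lemma (in cring) ideal_length_filtration:
  fixes M :: "nat \<Rightarrow> 'a set"
  assumes M0: "M 0 = {\<zero>}" and M: "\<And>l. l \<le> r \<Longrightarrow> ideal (M l) R"
    and gen: "\<And>l x. l < r \<Longrightarrow> x \<in> M (Suc l) \<Longrightarrow> \<exists>u\<in>carrier R. \<exists>m\<in>M l. x = u \<otimes> g l \<oplus> m"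
    and g: "\<And>l. l < r \<Longrightarrow> g l \<in> carrier R"
    and unit: "\<And>l u. l < r \<Longrightarrow> u \<in> carrier R \<Longrightarrow> u \<in> Units R \<or> u \<otimes> g l \<in> M l"
    and strict: "\<And>l. l < r \<Longrightarrow> M l \<subset> M (Suc l)"
  shows "ideal_length R (M r) = enat r"
  unfolding ideal_length_def
proof (rule antisym)
  have mono: "M i \<subseteq> M r" if "i \<le> r" for i
    using that
  proof (induction rule: inc_induct)
    case (step n)
    then show ?case using strict[of n] by auto
  qed simp
  show "(SUP l\<in>{l. \<exists>c. (\<forall>i\<le>l. ideal (c i) R \<and> c i \<subseteq> M r) \<and> (\<forall>i<l. c i \<subset> c (Suc i))}. enat l) \<le> enat r"
  proof (rule SUP_least)
    fix k assume "k \<in> {l. \<exists>c. (\<forall>i\<le>l. ideal (c i) R \<and> c i \<subseteq> M r) \<and> (\<forall>i<l. c i \<subset> c (Suc i))}"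
    then obtain c where "\<forall>i\<le>k. ideal (c i) R \<and> c i \<subseteq> M r" "\<forall>i<k. c i \<subset> c (Suc i)" by blast
    then have "k \<le> r"
      by (intro filtration_bounds_chains[where M = M and g = g and c = c]) (use assms in auto)
    then show "enat k \<le> enat r" by simp
  qed
  show "enat r \<le> (SUP l\<in>{l. \<exists>c. (\<forall>i\<le>l. ideal (c i) R \<and> c i \<subseteq> M r) \<and> (\<forall>i<l. c i \<subset> c (Suc i))}. enat l)"
    by (rule SUP_upper) (use M mono strict in blast)
qed

text \<open>The ideals \<open>(p^k a)\<close> decrease inside \<open>N\<close>, so finite length forces two consecutive ones to agree. In a
local ring with \<open>p\<close> in the maximal ideal this makes \<open>p^k a\<close> vanish, as \<open>1 - b p\<close> is a unit.\<close>

lemma (in cring) finite_length_power_stable: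
  assumes N: "ideal N R" and fin: "ideal_length R N < \<infinity>" and a: "a \<in> N" and p: "p \<in> carrier R"
  shows "\<exists>k. \<exists>b\<in>carrier R. p [^] (k::nat) \<otimes> a = b \<otimes> (p [^] Suc k \<otimes> a)"
proof (rule ccontr)
  assume neg: "\<not> ?thesis"
  interpret N: ideal N R by fact
  define c where "c k = {b \<otimes> (p [^] k \<otimes> a) | b. b \<in> carrier R}" for k :: nat
  have ac: "a \<in> carrier R" using a N.Icarr by blast
  have pa: "p [^] k \<otimes> a \<in> carrier R" for k :: nat using p ac by simp
  have ideal: "ideal (c k) R" for k
    using cgenideal_ideal[OF pa[of k]] unfolding c_def cgenideal_def .
  have sub: "c k \<subseteq> N" for k
    using N.I_l_closed[OF N.I_l_closed[OF a]] p by (auto simp: c_def)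
  have mem: "p [^] k \<otimes> a \<in> c k" for k
    unfolding c_def using pa[of k] by (intro CollectI exI[of _ \<one>]) auto
  have strict: "c (Suc k) \<subset> c k" for k
  proof
    show "c (Suc k) \<subseteq> c k"
    proof
      fix x assume "x \<in> c (Suc k)"
      then obtain b where b: "b \<in> carrier R" "x = b \<otimes> (p [^] Suc k \<otimes> a)" by (auto simp: c_def)
      then have "x = (b \<otimes> p) \<otimes> (p [^] k \<otimes> a)"
        using p ac by (simp add: m_ac)
      then show "x \<in> c k" using b p by (auto simp: c_def)
    qed
    show "c (Suc k) \<noteq> c k"
    proof
      assume "c (Suc k) = c k"
      then have "p [^] k \<otimes> a \<in> c (Suc k)" using mem[of k] by simp
      then show False using neg unfolding c_def by blast
    qed
  qed
  have "enat l \<le> ideal_length R N" for l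
    unfolding ideal_length_def
  proof (rule SUP_upper, intro CollectI exI[of _ "\<lambda>i. c (l - i)"] conjI allI impI)
    show "c (l - i) \<subset> c (l - Suc i)" if "i < l" for i
      using strict[of "l - Suc i"] that by (simp add: Suc_diff_Suc)
  qed (use ideal sub in auto)
  from this[of "Suc (the_enat (ideal_length R N))"] fin show False
    by (cases "ideal_length R N") auto
qed

section \<open>Multiplicity of an ideal at a prime\<close>

text \<open>For a prime \<open>P\<close> and an ideal \<open>I\<close> of the ring \<open>R\<close> with carrier \<open>C\<close>, the local ring \<open>A = R\<^sub>P / I R\<^sub>P\<close> is
handled entirely through elements of \<open>R\<close>: its elements are the classes \<open>q f s\<close> of fractions \<open>f / s\<close>,
and all its ideals that are needed are extensions \<open>ext K\<close> of ideals \<open>K\<close> of \<open>R\<close> for which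
membership of \<open>f / s\<close> only depends on \<open>f\<close>.\<close>

locale prime_localization =
  fixes C :: "'a::idom set" and P I :: "'a set"
  assumes cring_R: "cring (ambient_subring C)"
    and prime: "primeideal P (ambient_subring C)"
    and ideal_I: "ideal I (ambient_subring C)"
begin

definition "Loc = localization (ambient_subring C) P"
definition "IL = Idl\<^bsub>Loc\<^esub> ((\<lambda>a. Fract a 1) ` I)"
definition "A = local_quotient (ambient_subring C) I P"

definition q :: "'a \<Rightarrow> 'a \<Rightarrow> 'a fract set" where "q f s = IL +>\<^bsub>Loc\<^esub> Fract f s"
text \<open>The contraction of \<open>I R\<^sub>P\<close> to \<open>R\<close>, so that \<open>q f s = 0\<close> iff \<open>f \<in> sat\<close>.\<close>

definition sat :: "'a set" where "sat = {f \<in> C. \<exists>t\<in>C - P. t * f \<in> I}"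

lemmas C_closed [intro] = ambient_subring_closed[OF cring_R]
lemmas I_ideal = ideal_ambient_subringD[OF cring_R ideal_I]

lemma P_ideal: "ideal P (ambient_subring C)"
  by (rule primeideal.axioms(1)[OF prime])

lemmas P_ideal' = ideal_ambient_subringD[OF cring_R P_ideal]

lemma one_notin_P: "1 \<notin> P"
  using ideal.one_imp_carrier[OF P_ideal] primeideal.I_notcarr[OF prime] by auto

declare one_notin_P [simp] C_closed(1) [simp]

lemma P_prime: "x \<in> C \<Longrightarrow> y \<in> C \<Longrightarrow> x * y \<in> P \<Longrightarrow> x \<in> P \<or> y \<in> P"
  using primeideal.I_prime[OF prime, of x y] by simp

lemma one_in_S [simp, intro]: "1 \<in> C - P"
  using one_notin_P by auto

lemma mult_in_S [intro]: "s \<in> C - P \<Longrightarrow> t \<in> C - P \<Longrightarrow> s * t \<in> C - P"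
  using P_prime C_closed(6) by blast

lemma P_prime_iff: "x \<in> C \<Longrightarrow> y \<in> C \<Longrightarrow> x * y \<in> P \<longleftrightarrow> x \<in> P \<or> y \<in> P"
  by (metis P_prime P_ideal'(5,6))

lemma S_nonzero: "s \<in> C - P \<Longrightarrow> s \<noteq> 0"
  using P_ideal'(2) by auto

lemma Loc_eq: "Loc = ambient_subring {Fract a s | a s. a \<in> C \<and> s \<in> C - P}"
  by (simp add: Loc_def localization_def ambient_subring_def)

lemma Fract_in_Loc [intro]: "a \<in> C \<Longrightarrow> s \<in> C - P \<Longrightarrow> Fract a s \<in> carrier Loc"
  by (auto simp: Loc_eq)

lemma Loc_ops [simp]: "mult Loc = (*)" "add Loc = (+)" "one Loc = 1" "zero Loc = 0"
  by (simp_all add: Loc_eq)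

lemma cring_Loc: "cring Loc"
  unfolding Loc_eq
proof (rule cring_ambient_subring)
  let ?L = "{Fract a s | a s. a \<in> C \<and> s \<in> C - P}"
  have memI: "Fract a s \<in> ?L" if "a \<in> C" "s \<in> C - P" for a s
    using that by blast
  show "1 \<in> ?L" using memI[OF C_closed(1) one_in_S] unfolding One_fract_def .
  fix x y assume "x \<in> ?L" "y \<in> ?L"
  then obtain a s b t where x: "x = Fract a s" "a \<in> C" "s \<in> C - P"
    and y: "y = Fract b t" "b \<in> C" "t \<in> C - P" by blast
  have st: "s * t \<in> C - P" using x y by (intro mult_in_S)
  show "x + y \<in> ?L" using memI[OF _ st, of "a * t + b * s"] x y S_nonzero[OF x(3)] S_nonzero[OF y(3)]
    by (auto simp: add_fract)
  show "x * y \<in> ?L" using memI[OF _ st, of "a * b"] x y by auto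
  show "- x \<in> ?L" using memI[OF _ x(3), of "- a"] x by auto
qed

lemma Fract_mem_iff:
  assumes I: "ideal K (ambient_subring C)" and f: "f \<in> C" "s \<in> C - P"
  shows "Fract f s \<in> {Fract a s | a s. a \<in> K \<and> s \<in> C - P} \<longleftrightarrow> (\<exists>t\<in>C - P. t * f \<in> K)"
proof
  note K = ideal_ambient_subringD[OF cring_R I]
  assume "Fract f s \<in> {Fract a s | a s. a \<in> K \<and> s \<in> C - P}"
  then obtain a t where at: "a \<in> K" "t \<in> C - P" "Fract f s = Fract a t" by blast
  then have "f * t = a * s" using f S_nonzero by (simp add: eq_fract)
  then have "t * f \<in> K" using K(6)[of s a] at f by (simp add: mult.commute)
  then show "\<exists>t\<in>C - P. t * f \<in> K" using at by blast
next
  assume "\<exists>t\<in>C - P. t * f \<in> K"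
  then obtain t where t: "t \<in> C - P" "t * f \<in> K" by blast
  have "Fract f s = Fract (t * f) (t * s)"
    using t f by (simp add: S_nonzero eq_fract)
  moreover have "t * s \<in> C - P" using t(1) f(2) by (rule mult_in_S)
  ultimately show "Fract f s \<in> {Fract a s | a s. a \<in> K \<and> s \<in> C - P}" using t(2) by blast
qed

lemma ideal_extension_Loc:
  assumes I: "ideal K (ambient_subring C)"
  shows "ideal {Fract a s | a s. a \<in> K \<and> s \<in> C - P} Loc"
  unfolding Loc_eq ideal_ambient_subring_iff[OF cring_Loc[unfolded Loc_eq]]
proof (intro conjI ballI)
  note K = ideal_ambient_subringD[OF cring_R I]
  let ?E = "{Fract a s | a s. a \<in> K \<and> s \<in> C - P}"
  have memI: "Fract a s \<in> ?E" if "a \<in> K" "s \<in> C - P" for a s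
    using that by blast
  show "?E \<subseteq> {Fract a s |a s. a \<in> C \<and> s \<in> C - P}" using K(1) by blast
  show "0 \<in> ?E" using memI[OF K(2) one_in_S] by (simp add: Zero_fract_def)
  show "x + y \<in> ?E" if "x \<in> ?E" "y \<in> ?E" for x y
  proof -
    from that obtain a s b t where x: "x = Fract a s" "a \<in> K" "s \<in> C - P"
      and y: "y = Fract b t" "b \<in> K" "t \<in> C - P" by blast
    have "x + y = Fract (a * t + b * s) (s * t)"
      using x y S_nonzero by (simp add: add_fract)
    moreover have "a * t + b * s \<in> K" using x y by (intro K(3) K(6)) auto
    ultimately show ?thesis using memI mult_in_S[OF x(3) y(3)] by simp
  qed
  show "r * y \<in> ?E" if "r \<in> {Fract a s |a s. a \<in> C \<and> s \<in> C - P}" "y \<in> ?E" for r y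
  proof -
    from that obtain a s b t where x: "r = Fract a s" "a \<in> C" "s \<in> C - P"
      and y: "y = Fract b t" "b \<in> K" "t \<in> C - P" by blast
    have "a * b \<in> K" using x y by (intro K(5))
    then show ?thesis using memI[OF _ mult_in_S[OF x(3) y(3)]] x y by simp
  qed
qed

lemma IL_eq: "IL = {Fract a s | a s. a \<in> I \<and> s \<in> C - P}" (is "_ = ?E")
proof
  interpret Loc: cring Loc by (rule cring_Loc)
  have carr: "(\<lambda>a. Fract a 1) ` I \<subseteq> carrier Loc"
    using I_ideal(1) Fract_in_Loc[OF _ one_in_S] by blast
  show "IL \<subseteq> ?E"
    unfolding IL_def by (intro Loc.genideal_minimal ideal_extension_Loc[OF ideal_I])
      (use one_in_S in blast)
  show "?E \<subseteq> IL"
  proof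
    fix x assume "x \<in> ?E"
    then obtain a s where x: "x = Fract a s" "a \<in> I" "s \<in> C - P" by blast
    interpret IL: ideal IL Loc
      unfolding IL_def by (rule Loc.genideal_ideal[OF carr])
    have "Fract a 1 \<in> IL" using Loc.genideal_self[OF carr] x(2) by (auto simp: IL_def)
    from IL.I_l_closed[OF this Fract_in_Loc[of 1 s]] x show "x \<in> IL" by auto
  qed
qed

lemma ideal_IL: "ideal IL Loc"
  unfolding IL_eq by (rule ideal_extension_Loc[OF ideal_I])

lemma A_eq: "A = Loc Quot IL"
  by (simp add: A_def local_quotient_def Loc_def IL_def)

lemma cring_A: "cring A"
  unfolding A_eq by (rule ideal.quotient_is_cring[OF ideal_IL cring_Loc])

sublocale A: cring A
  by (rule cring_A)

lemma hom: "((+>\<^bsub>Loc\<^esub>) IL) \<in> ring_hom Loc A"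
  unfolding A_eq by (rule ideal.rcos_ring_hom[OF ideal_IL])

lemma q_carrier [intro, simp]: "f \<in> C \<Longrightarrow> s \<in> C - P \<Longrightarrow> q f s \<in> carrier A"
  unfolding q_def by (rule ring_hom_closed[OF hom]) (rule Fract_in_Loc)

lemma A_cases:
  assumes "x \<in> carrier A"
  obtains f s where "f \<in> C" "s \<in> C - P" "x = q f s"
  using assms unfolding A_eq FactRing_def A_RCOSETS_def' q_def
  by (auto simp: Loc_eq)

lemma q_mult:
  assumes "f \<in> C" "s \<in> C - P" "g \<in> C" "t \<in> C - P"
  shows "q f s \<otimes>\<^bsub>A\<^esub> q g t = q (f * g) (s * t)"
  using ring_hom_mult[OF hom Fract_in_Loc[OF assms(1,2)] Fract_in_Loc[OF assms(3,4)]]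
  by (simp add: q_def)

lemma q_add:
  assumes "f \<in> C" "s \<in> C - P" "g \<in> C" "t \<in> C - P"
  shows "q f s \<oplus>\<^bsub>A\<^esub> q g t = q (f * t + g * s) (s * t)"
  using ring_hom_add[OF hom Fract_in_Loc[OF assms(1,2)] Fract_in_Loc[OF assms(3,4)]]
    S_nonzero[OF assms(2)] S_nonzero[OF assms(4)]
  by (simp add: q_def add_fract)

lemma q_one: "q 1 1 = \<one>\<^bsub>A\<^esub>"
  using ring_hom_one[OF hom] by (simp add: q_def One_fract_def)

lemma q_eq_iff:
  assumes "f \<in> C" "s \<in> C - P" "g \<in> C" "t \<in> C - P"
  shows "q f s = q g t \<longleftrightarrow> f * t - g * s \<in> sat"
proof -
  interpret Loc: cring Loc by (rule cring_Loc)
  have "Fract f s \<ominus>\<^bsub>Loc\<^esub> Fract g t = Fract f s - Fract g t"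
    using uminus_in_ambient_subring(2)[OF cring_Loc[unfolded Loc_eq], of "Fract g t"] assms
    by (auto simp: a_minus_def Loc_eq)
  also have "\<dots> = Fract (f * t - g * s) (s * t)"
    using assms S_nonzero by (simp add: diff_fract)
  finally have eq: "Fract f s \<ominus>\<^bsub>Loc\<^esub> Fract g t = Fract (f * t - g * s) (s * t)" .
  have C: "f * t - g * s \<in> C" using assms by auto
  have "q f s = q g t \<longleftrightarrow> Fract f s \<ominus>\<^bsub>Loc\<^esub> Fract g t \<in> IL"
    unfolding q_def
    by (rule sym, rule Loc.quotient_eq_iff_same_a_r_cos[OF ideal_IL]) (use assms in auto)
  also have "\<dots> \<longleftrightarrow> f * t - g * s \<in> sat"
    unfolding eq IL_eq using Fract_mem_iff[OF ideal_I C mult_in_S[OF assms(2,4)]] C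
    by (simp add: sat_def)
  finally show ?thesis .
qed

lemma q_zero: "q 0 1 = \<zero>\<^bsub>A\<^esub>"
proof -
  have "Fract 0 1 \<in> IL" unfolding IL_eq using I_ideal(2) one_in_S by blast
  then show ?thesis
    unfolding q_def A_eq FactRing_def using ring.a_rcos_zero[OF cring.axioms(1)[OF cring_Loc] ideal_IL]
    by simp
qed

lemma q_unit:
  assumes "f \<in> C - P" "s \<in> C - P"
  shows "q f s \<in> Units A"
proof -
  have sq: "q s f \<in> carrier A" "q f s \<in> carrier A" using assms by auto
  have "f * s \<noteq> 0" using S_nonzero[OF mult_in_S[OF assms]] .
  then have "Fract (f * s) (s * f) = Fract 1 1" by (simp add: eq_fract mult.commute)
  then have "q f s \<otimes>\<^bsub>A\<^esub> q s f = q 1 1"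
    using q_mult[of f s s f] assms by (simp add: q_def)
  then have "q f s \<otimes>\<^bsub>A\<^esub> q s f = \<one>\<^bsub>A\<^esub>" "q s f \<otimes>\<^bsub>A\<^esub> q f s = \<one>\<^bsub>A\<^esub>"
    using sq A.m_comm by (simp_all add: q_one)
  then show ?thesis using sq unfolding Units_def by blast
qed

definition ext :: "'a set \<Rightarrow> 'a fract set set" where
  "ext K = {q f s | f s. f \<in> K \<and> s \<in> C - P}"

text \<open>The ideals of \<open>R\<close> that are contractions of ideals of \<open>A\<close>.\<close>

definition saturated :: "'a set \<Rightarrow> bool" where
  "saturated K \<longleftrightarrow> ideal K (ambient_subring C) \<and> I \<subseteq> K \<and> (\<forall>f\<in>C. \<forall>t\<in>C - P. t * f \<in> K \<longrightarrow> f \<in> K)"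

lemma sat_subset: "saturated K \<Longrightarrow> sat \<subseteq> K"
  unfolding saturated_def sat_def by blast

lemma q_in_ext_iff:
  assumes K: "saturated K" and f: "f \<in> C" "s \<in> C - P"
  shows "q f s \<in> ext K \<longleftrightarrow> f \<in> K"
proof
  assume "q f s \<in> ext K"
  then obtain g t where g: "g \<in> K" "t \<in> C - P" "q f s = q g t" by (auto simp: ext_def)
  have id: "ideal K (ambient_subring C)" using K by (simp add: saturated_def)
  note Kid = ideal_ambient_subringD[OF cring_R id]
  have "g \<in> C" using Kid(1) g by blast
  then have "f * t - g * s \<in> K"
    using g f q_eq_iff[OF f, of g t] sat_subset[OF K] by auto
  moreover have "g * s \<in> K" using Kid(6) g f by auto
  ultimately have "(f * t - g * s) + g * s \<in> K" by (rule Kid(3))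
  then have "t * f \<in> K" by (simp add: mult.commute)
  then show "f \<in> K" using K f g by (auto simp: saturated_def)
qed (use f in \<open>auto simp: ext_def\<close>)

lemma ideal_ext:
  assumes K: "saturated K"
  shows "ideal (ext K) A"
proof (rule idealI)
  have id: "ideal K (ambient_subring C)" using K by (simp add: saturated_def)
  note Kid = ideal_ambient_subringD[OF cring_R id]
  have memI: "q a s \<in> ext K" if "a \<in> K" "s \<in> C - P" for a s
    using that by (auto simp: ext_def)
  have carr: "ext K \<subseteq> carrier A" using Kid(1) by (auto simp: ext_def)
  have mult: "x \<otimes>\<^bsub>A\<^esub> a \<in> ext K" if "a \<in> ext K" "x \<in> carrier A" for a x
  proof -
    obtain f s where a: "a = q f s" "f \<in> K" "s \<in> C - P" using \<open>a \<in> ext K\<close> by (auto simp: ext_def)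
    obtain g t where x: "x = q g t" "g \<in> C" "t \<in> C - P" using A_cases[OF \<open>x \<in> carrier A\<close>] by metis
    have "f \<in> C" using a Kid(1) by blast
    then have "x \<otimes>\<^bsub>A\<^esub> a = q (g * f) (t * s)" using a x by (simp add: q_mult)
    then show ?thesis using memI[OF Kid(5)[OF x(2) a(2)] mult_in_S[OF x(3) a(3)]] by simp
  qed
  show "ring A" by (rule A.ring_axioms)
  show "subgroup (ext K) (add_monoid A)"
  proof
    show "ext K \<subseteq> carrier (add_monoid A)" using carr by simp
    show "x \<otimes>\<^bsub>add_monoid A\<^esub> y \<in> ext K" if "x \<in> ext K" "y \<in> ext K" for x y
    proof -
      obtain f s where a: "x = q f s" "f \<in> K" "s \<in> C - P" using \<open>x \<in> ext K\<close> by (auto simp: ext_def)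
      obtain g t where b: "y = q g t" "g \<in> K" "t \<in> C - P" using \<open>y \<in> ext K\<close> by (auto simp: ext_def)
      have "f \<in> C" "g \<in> C" using a b Kid(1) by auto
      then have eq: "x \<oplus>\<^bsub>A\<^esub> y = q (f * t + g * s) (s * t)" using a b by (simp add: q_add)
      have "f * t + g * s \<in> K" using a b by (intro Kid(3) Kid(6)) auto
      from memI[OF this mult_in_S[OF a(3) b(3)]] show ?thesis by (simp add: eq)
    qed
    show "\<one>\<^bsub>add_monoid A\<^esub> \<in> ext K" using memI[OF Kid(2) one_in_S] by (simp add: q_zero)
    show "inv\<^bsub>add_monoid A\<^esub> x \<in> ext K" if "x \<in> ext K" for x
    proof -
      have x: "x \<in> carrier A" using that carr by blast
      have "inv\<^bsub>add_monoid A\<^esub> x = (\<ominus>\<^bsub>A\<^esub> \<one>\<^bsub>A\<^esub>) \<otimes>\<^bsub>A\<^esub> x"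
        using A.l_minus[of "\<one>\<^bsub>A\<^esub>" x] x by (simp add: a_inv_def)
      then show ?thesis using mult[OF that, of "\<ominus>\<^bsub>A\<^esub> \<one>\<^bsub>A\<^esub>"] by simp
    qed
  qed
  show "x \<otimes>\<^bsub>A\<^esub> a \<in> ext K" if "a \<in> ext K" "x \<in> carrier A" for a x using mult[OF that] .
  show "a \<otimes>\<^bsub>A\<^esub> x \<in> ext K" if "a \<in> ext K" "x \<in> carrier A" for a x
    using mult[OF that] A.m_comm[of a x] that carr by auto
qed

lemma q_power: "f \<in> C \<Longrightarrow> q f 1 [^]\<^bsub>A\<^esub> (k::nat) = q (f ^ k) 1"
proof (induction k)
  case (Suc k)
  then show ?case using C_closed(7)[of f k] by (simp add: q_mult mult.commute)
qed (simp add: q_one)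

text \<open>Ideals of finite length consist of elements that are killed by a power of each element of \<open>P\<close>. This
is the only property of finite length that is used to bound the largest such ideal from above.\<close>

lemma finite_length_annihilated:
  assumes N: "ideal N A" and fin: "ideal_length A N < \<infinity>" and fs: "q f s \<in> N" "f \<in> C" "s \<in> C - P"
    and p: "p \<in> P"
  shows "\<exists>k. p ^ k * f \<in> sat"
proof -
  have pC: "p \<in> C" using p P_ideal'(1) by blast
  obtain k :: nat and b where b: "b \<in> carrier A"
    and eq: "q p 1 [^]\<^bsub>A\<^esub> k \<otimes>\<^bsub>A\<^esub> q f s = b \<otimes>\<^bsub>A\<^esub> (q p 1 [^]\<^bsub>A\<^esub> Suc k \<otimes>\<^bsub>A\<^esub> q f s)"
    using A.finite_length_power_stable[OF N fin fs(1) q_carrier[OF pC one_in_S]] by blast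
  obtain g t where g: "g \<in> C" "t \<in> C - P" "b = q g t" using A_cases[OF b] by metis
  have pw: "p ^ k * f \<in> C" "p ^ Suc k * f \<in> C" "p ^ k \<in> C" "p ^ Suc k \<in> C"
    using pC fs by (auto simp del: power_Suc)
  have "q (p ^ k * f) s = q (g * (p ^ Suc k * f)) (t * s)"
    using eq pw fs(2,3) g(1,2) unfolding q_power[OF pC] g(3)
    by (simp add: q_mult C_closed P_prime_iff del: power_Suc)
  moreover have "g * (p ^ Suc k * f) \<in> C" "t * s \<in> C - P"
    using g fs pw mult_in_S[of t s] by auto
  ultimately have "p ^ k * f * (t * s) - g * (p ^ Suc k * f) * s \<in> sat"
    using q_eq_iff[OF pw(1) fs(3)] by metis
  then obtain w where w: "w \<in> C - P" "w * (p ^ k * f * (t * s) - g * (p ^ Suc k * f) * s) \<in> I"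
    by (auto simp: sat_def)
  \<comment> \<open>The element \<open>t - g p\<close> is the numerator of \<open>1 - (g / t) p\<close>, a unit of the local ring.\<close>
  have "g * p \<in> P" using P_ideal'(5) g p by auto
  then have "t - g * p \<notin> P" using P_ideal'(3)[of "t - g * p" "g * p"] g by auto
  moreover have "t - g * p \<in> C" using g pC by auto
  ultimately have "w * (t - g * p) * s \<in> C - P" using w fs by (intro mult_in_S) auto
  moreover have "w * (t - g * p) * s * (p ^ k * f) \<in> I"
    using w(2) by (simp add: algebra_simps)
  ultimately have "p ^ k * f \<in> sat" unfolding sat_def using pw by blast
  then show ?thesis by blast
qed

text \<open>Computing a multiplicity inside \<open>R\<close>. The filtration \<open>K 0 = sat, \<dots>, K r\<close> has one new generator \<open>g l\<close> at each
step, which \<open>P\<close> multiplies into the previous ideal; so each factor of its extension to \<open>A\<close> is simple, and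
\<open>ext (K r)\<close> has length \<open>r\<close>. The assumption \<open>top\<close> says that \<open>K r\<close> contains everything that a finite-length
ideal can contain, so \<open>ext (K r)\<close> is the largest one.\<close>

theorem multiplicity_by_filtration:
  fixes K :: "nat \<Rightarrow> 'a set" and g :: "nat \<Rightarrow> 'a"
  assumes K0: "K 0 \<subseteq> sat" and K: "\<And>l. l \<le> r \<Longrightarrow> saturated (K l)"
    and g: "\<And>l. l < r \<Longrightarrow> g l \<in> K (Suc l) - K l"
    and mono: "\<And>l. l < r \<Longrightarrow> K l \<subseteq> K (Suc l)"
    and gen: "\<And>l f. l < r \<Longrightarrow> f \<in> K (Suc l) \<Longrightarrow> \<exists>u\<in>C. f - u * g l \<in> K l"
    and ann: "\<And>l p. l < r \<Longrightarrow> p \<in> P \<Longrightarrow> p * g l \<in> K l"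
    and top: "\<And>f. f \<in> C \<Longrightarrow> (\<And>p. p \<in> P \<Longrightarrow> \<exists>k. p ^ k * f \<in> sat) \<Longrightarrow> f \<in> K r"
  shows "the_enat (ideal_length A (largest_finite_length_ideal A)) = r"
proof -
  define M where "M l = ext (K l)" for l
  have KC: "K l \<subseteq> C" if "l \<le> r" for l
    using K[OF that] ideal_ambient_subringD(1)[OF cring_R] by (simp add: saturated_def)
  have gC: "g l \<in> C" if "l < r" for l
    using g[OF that] KC[of "Suc l"] that by auto
  have M: "ideal (M l) A" if "l \<le> r" for l
    unfolding M_def by (rule ideal_ext[OF K[OF that]])
  have len: "ideal_length A (M r) = enat r"
  proof (rule A.ideal_length_filtration[where g = "\<lambda>l. q (g l) 1"])
    show "M 0 = {\<zero>\<^bsub>A\<^esub>}"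
    proof
      have "0 \<in> K 0"
        using K[of 0] ideal_ambient_subringD(2)[OF cring_R] by (auto simp: saturated_def)
      then have "q 0 1 \<in> M 0" using one_in_S unfolding M_def ext_def by blast
      then show "{\<zero>\<^bsub>A\<^esub>} \<subseteq> M 0" using q_zero by simp
      show "M 0 \<subseteq> {\<zero>\<^bsub>A\<^esub>}"
      proof
        fix x assume "x \<in> M 0"
        then obtain f s where x: "x = q f s" "f \<in> K 0" "s \<in> C - P" by (auto simp: M_def ext_def)
        have "f \<in> C" using x KC by blast
        then have "q f s = q 0 1"
          using x K0 q_eq_iff[of f s 0 1] C_closed(2) by auto
        then show "x \<in> {\<zero>\<^bsub>A\<^esub>}" using x q_zero by simp
      qed
    qed
    show "ideal (M l) A" if "l \<le> r" for l by (rule M[OF that])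
    show "q (g l) 1 \<in> carrier A" if "l < r" for l by (rule q_carrier[OF gC[OF that] one_in_S])
    show "\<exists>u\<in>carrier A. \<exists>m\<in>M l. x = u \<otimes>\<^bsub>A\<^esub> q (g l) 1 \<oplus>\<^bsub>A\<^esub> m"
      if l: "l < r" and "x \<in> M (Suc l)" for l x
    proof -
      obtain f s where x: "x = q f s" "f \<in> K (Suc l)" "s \<in> C - P"
        using \<open>x \<in> M (Suc l)\<close> by (auto simp: M_def ext_def)
      obtain u where u: "u \<in> C" "f - u * g l \<in> K l" using gen[OF l x(2)] by blast
      have fu: "f - u * g l \<in> C" using u KC[of l] l by auto
      have "q u s \<otimes>\<^bsub>A\<^esub> q (g l) 1 \<oplus>\<^bsub>A\<^esub> q (f - u * g l) s = q (u * g l * s + (f - u * g l) * s) (s * s)"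
        using u(1) x(3) gC[OF l] fu C_closed(6)[OF u(1) gC[OF l]]
        by (simp add: q_mult q_add)
      also have "\<dots> = q f s"
      proof -
        have "u * g l * s + (f - u * g l) * s = f * s" by (simp add: algebra_simps)
        then show ?thesis
          unfolding q_def using S_nonzero[OF x(3)] eq_fract(1)[of "s * s" s "f * s" f] by simp
      qed
      finally have "x = q u s \<otimes>\<^bsub>A\<^esub> q (g l) 1 \<oplus>\<^bsub>A\<^esub> q (f - u * g l) s" using x by simp
      moreover have "q (f - u * g l) s \<in> M l" using u x by (auto simp: M_def ext_def)
      ultimately show ?thesis using u x by blast
    qed
    show "u \<in> Units A \<or> u \<otimes>\<^bsub>A\<^esub> q (g l) 1 \<in> M l" if l: "l < r" and "u \<in> carrier A" for l u
    proof -
      obtain f s where u: "f \<in> C" "s \<in> C - P" "u = q f s"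
        using A_cases[OF \<open>u \<in> carrier A\<close>] by metis
      show ?thesis
      proof (cases "f \<in> P")
        case True
        then have "f * g l \<in> K l" by (rule ann[OF l])
        moreover have "u \<otimes>\<^bsub>A\<^esub> q (g l) 1 = q (f * g l) s" using u gC[OF l] by (simp add: q_mult)
        ultimately show ?thesis using u by (auto simp: M_def ext_def)
      next
        case False
        then show ?thesis using u q_unit by blast
      qed
    qed
    show "M l \<subset> M (Suc l)" if l: "l < r" for l
    proof
      show "M l \<subseteq> M (Suc l)" using mono[OF l] by (auto simp: M_def ext_def)
      have "q (g l) 1 \<in> M (Suc l)" "q (g l) 1 \<notin> M l"
        unfolding M_def using q_in_ext_iff[OF K] g[OF l] gC[OF l] l by auto
      then show "M l \<noteq> M (Suc l)" by blast
    qed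
  qed
  have largest: "N \<subseteq> M r" if N: "ideal N A" "ideal_length A N < \<infinity>" for N
  proof
    fix x assume "x \<in> N"
    then have "x \<in> carrier A" using ideal.Icarr[OF N(1)] by blast
    then obtain f s where x: "f \<in> C" "s \<in> C - P" "x = q f s" by (rule A_cases)
    have "f \<in> K r"
      by (rule top[OF x(1)], rule finite_length_annihilated[OF N _ x(1,2)]) (use \<open>x \<in> N\<close> x in auto)
    then show "x \<in> M r" using x by (auto simp: M_def ext_def)
  qed
  have "largest_finite_length_ideal A = M r"
    unfolding largest_finite_length_ideal_def
  proof (rule the_equality)
    show "ideal (M r) A \<and> ideal_length A (M r) < \<infinity> \<and>
        (\<forall>N'. ideal N' A \<and> ideal_length A N' < \<infinity> \<longrightarrow> N' \<subseteq> M r)"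
      using M[of r] len largest by simp
    then show "N = M r" if "ideal N A \<and> ideal_length A N < \<infinity> \<and>
        (\<forall>N'. ideal N' A \<and> ideal_length A N' < \<infinity> \<longrightarrow> N' \<subseteq> N)" for N
      using that by blast
  qed
  then show ?thesis using len by simp
qed

end

abbreviation "keys \<equiv> Poly_Mapping.keys"
abbreviation "lookup \<equiv> Poly_Mapping.lookup"

section \<open>Monomial ideals\<close>

text \<open>A monomial ideal is given by the predicate that its exponent vectors satisfy. Intersections, sums and products
of monomial ideals then become statements about exponent vectors.\<close>

definition mono_ideal :: "nat \<Rightarrow> ((nat \<Rightarrow>\<^sub>0 nat) \<Rightarrow> bool) \<Rightarrow> 'k::field mpoly set" where
  "mono_ideal n U = {f. \<forall>u\<in>keys f. keys u \<subseteq> {1..n} \<and> U u}"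

definition upclosed :: "((nat \<Rightarrow>\<^sub>0 nat) \<Rightarrow> bool) \<Rightarrow> bool" where
  "upclosed U \<longleftrightarrow> (\<forall>u v. U u \<longrightarrow> U (u + v))"

lemma upclosedD: "upclosed U \<Longrightarrow> U u \<Longrightarrow> U (u + v)"
  by (simp add: upclosed_def)

lemma keys_add_nat: "keys (u + v :: nat \<Rightarrow>\<^sub>0 nat) = keys u \<union> keys v"
  by (auto simp: in_keys_iff lookup_add)

lemma in_keys_multE:
  fixes f g :: "'k::field mpoly"
  assumes "u \<in> keys (f * g)"
  obtains v w where "v \<in> keys f" "w \<in> keys g" "u = v + w"
  using keys_mult[of f g] assms by blast

lemma carrier_poly_ring: "carrier (poly_ring n) = (mono_ideal n (\<lambda>_. True) :: 'k::field mpoly set)"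
  by (simp add: poly_ring_def mono_ideal_def)

lemma poly_ring_eq: "poly_ring n = ambient_subring (carrier (poly_ring n) :: 'k::field mpoly set)"
  by (simp add: poly_ring_def ambient_subring_def)

lemma mono_ideal_0 [simp]: "0 \<in> mono_ideal n U"
  by (simp add: mono_ideal_def)

lemma mono_ideal_add: "f \<in> mono_ideal n U \<Longrightarrow> g \<in> mono_ideal n U \<Longrightarrow> f + g \<in> mono_ideal n U"
  using keys_add[of f g] by (auto simp: mono_ideal_def)

lemma mono_ideal_diff: "f \<in> mono_ideal n U \<Longrightarrow> g \<in> mono_ideal n U \<Longrightarrow> f - g \<in> mono_ideal n U"
  using keys_diff[of f g] by (auto simp: mono_ideal_def)

lemma mono_ideal_sum: "(\<And>x. x \<in> X \<Longrightarrow> h x \<in> mono_ideal n U) \<Longrightarrow> sum h X \<in> mono_ideal n U"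
  by (induction X rule: infinite_finite_induct) (auto intro: mono_ideal_add)

lemma mono_ideal_mult:
  assumes "upclosed U" "f \<in> mono_ideal n (\<lambda>_. True)" "g \<in> mono_ideal n U"
  shows "f * g \<in> mono_ideal n U"
  unfolding mono_ideal_def
proof (intro CollectI ballI)
  fix u assume "u \<in> keys (f * g)"
  then obtain v w where u: "v \<in> keys f" "w \<in> keys g" "u = w + v"
    by (metis in_keys_multE add.commute)
  then show "keys u \<subseteq> {1..n} \<and> U u"
    using assms upclosedD[OF assms(1), of w v] by (auto simp: mono_ideal_def keys_add_nat)
qed

lemma mono_ideal_mono: "(\<And>u. keys u \<subseteq> {1..n} \<Longrightarrow> U u \<Longrightarrow> V u) \<Longrightarrow> mono_ideal n U \<subseteq> mono_ideal n V"
  by (auto simp: mono_ideal_def)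

lemma mono_ideal_subset_carrier: "mono_ideal n U \<subseteq> mono_ideal n (\<lambda>_. True)"
  by (rule mono_ideal_mono) simp

lemma keys_monomial [simp]: "keys (monomial u :: 'k::field mpoly) = {u}"
  by (simp add: monomial_def)

lemma monomial_mono_ideal_iff [simp]:
  "(monomial u :: 'k::field mpoly) \<in> mono_ideal n U \<longleftrightarrow> keys u \<subseteq> {1..n} \<and> U u"
  by (simp add: mono_ideal_def)

lemma one_mono_ideal_iff [simp]: "(1 :: 'k::field mpoly) \<in> mono_ideal n U \<longleftrightarrow> U 0"
  by (simp add: mono_ideal_def)

lemma cring_poly_ring': "cring (ambient_subring (carrier (poly_ring n) :: 'k::field mpoly set))"
  unfolding carrier_poly_ring
proof (rule cring_ambient_subring)
  show "f * g \<in> mono_ideal n (\<lambda>_. True)"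
    if "f \<in> mono_ideal n (\<lambda>_. True)" "g \<in> mono_ideal n (\<lambda>_. True)" for f g :: "'k mpoly"
    by (rule mono_ideal_mult[OF _ that]) (simp add: upclosed_def)
  show "- f \<in> mono_ideal n (\<lambda>_. True)" if "f \<in> mono_ideal n (\<lambda>_. True)" for f :: "'k mpoly"
    using mono_ideal_diff[OF mono_ideal_0 that] by simp
qed (auto intro: mono_ideal_add)

lemma cring_poly_ring: "cring (poly_ring n :: 'k::field mpoly ring)"
  using cring_poly_ring'[of n] by (simp flip: poly_ring_eq)

lemma poly_ring_ops [simp]:
  "mult (poly_ring n) = (*)" "add (poly_ring n) = (+)" "one (poly_ring n) = 1" "zero (poly_ring n) = 0"
  by (simp_all add: poly_ring_def)

lemma ideal_poly_ring_iff:
  "ideal I (poly_ring n :: 'k::field mpoly ring) \<longleftrightarrow>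
    I \<subseteq> mono_ideal n (\<lambda>_. True) \<and> 0 \<in> I \<and> (\<forall>a\<in>I. \<forall>b\<in>I. a + b \<in> I) \<and>
    (\<forall>r\<in>mono_ideal n (\<lambda>_. True). \<forall>a\<in>I. r * a \<in> I)"
  using ideal_ambient_subring_iff[OF cring_poly_ring', of I n]
  unfolding poly_ring_eq[symmetric] unfolding carrier_poly_ring .

lemma ideal_mono_ideal: "upclosed U \<Longrightarrow> ideal (mono_ideal n U) (poly_ring n)"
  unfolding ideal_poly_ring_iff
  by (intro conjI ballI mono_ideal_subset_carrier mono_ideal_0 mono_ideal_add mono_ideal_mult)

lemma sum_terms: "f = (\<Sum>u\<in>keys f. Poly_Mapping.single u (lookup f u))"
proof (rule poly_mapping_eqI)
  fix v
  have "(\<Sum>u\<in>keys f. lookup (Poly_Mapping.single u (lookup f u)) v) =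
      (\<Sum>u\<in>keys f. if u = v then lookup f v else 0)"
    by (intro sum.cong) (auto simp: lookup_single when_def)
  also have "\<dots> = lookup f v" by (simp add: in_keys_iff)
  finally show "lookup f v = lookup (\<Sum>u\<in>keys f. Poly_Mapping.single u (lookup f u)) v"
    by (simp add: lookup_sum)
qed

lemma single_eq_mult_monomial:
  "Poly_Mapping.single u (c :: 'k::field) = Poly_Mapping.single 0 c * monomial u"
  by (simp add: monomial_def mult_single)

lemma constant_in_carrier: "Poly_Mapping.single 0 c \<in> mono_ideal n (\<lambda>_. True)"
  by (simp add: mono_ideal_def)

text \<open>Ideals are closed under multiplication by constants, so that inclusions of monomial ideals in other ideals can be checked
on monomials.\<close>

lemma mem_ideal_if_terms:
  fixes I :: "'k::field mpoly set"
  assumes I: "ideal I (poly_ring n)" and mem: "\<And>u. u \<in> keys f \<Longrightarrow> monomial u \<in> I"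
  shows "f \<in> I"
proof -
  note * = I[unfolded ideal_poly_ring_iff]
  have "(\<Sum>u\<in>X. Poly_Mapping.single u (lookup f u)) \<in> I" if "X \<subseteq> keys f" for X
    using finite_subset[OF that finite_keys] that
  proof (induction X rule: finite_induct)
    case (insert u X)
    have "Poly_Mapping.single u (lookup f u) \<in> I"
      unfolding single_eq_mult_monomial[of u] using * constant_in_carrier mem insert.prems by blast
    then show ?case using insert * by simp
  qed (use * in simp)
  from this[of "keys f"] show ?thesis using sum_terms[of f] by simp
qed

lemma Idl_monomials:
  assumes G: "\<And>g. g \<in> G \<Longrightarrow> keys g \<subseteq> {1..n}"
  shows "Idl\<^bsub>poly_ring n\<^esub> (monomial ` G) = (mono_ideal n (\<lambda>u. \<exists>g\<in>G. \<exists>v. u = g + v) :: 'k::field mpoly set)"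
    (is "?I = mono_ideal n ?U")
proof
  interpret R: cring "poly_ring n :: 'k mpoly ring" by (rule cring_poly_ring)
  have "upclosed ?U" unfolding upclosed_def by (metis add.assoc)
  then have "ideal (mono_ideal n ?U) (poly_ring n :: 'k mpoly ring)" by (rule ideal_mono_ideal)
  moreover have "monomial ` G \<subseteq> (mono_ideal n ?U :: 'k mpoly set)"
    using G by (auto intro!: bexI exI[of _ 0])
  ultimately show "?I \<subseteq> mono_ideal n ?U" by (rule R.genideal_minimal)
  have carr: "monomial ` G \<subseteq> carrier (poly_ring n :: 'k mpoly ring)"
    using G by (auto simp: carrier_poly_ring)
  have I: "ideal ?I (poly_ring n)" by (rule R.genideal_ideal[OF carr])
  show "mono_ideal n ?U \<subseteq> ?I"
  proof
    fix f :: "'k mpoly" assume f: "f \<in> mono_ideal n ?U"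
    show "f \<in> ?I"
    proof (rule mem_ideal_if_terms[OF I])
      fix u assume "u \<in> keys f"
      then obtain g v where u: "g \<in> G" "u = g + v" "keys u \<subseteq> {1..n}"
        using f by (auto simp: mono_ideal_def)
      have "(monomial v :: 'k mpoly) \<in> mono_ideal n (\<lambda>_. True)" using u by (auto simp: keys_add_nat)
      moreover have "monomial g \<in> ?I" using R.genideal_self[OF carr] u by blast
      ultimately have "monomial v * monomial g \<in> ?I" using I[unfolded ideal_poly_ring_iff] by blast
      then show "monomial u \<in> ?I" using u by (simp add: monomial_def mult_single add.commute)
    qed
  qed
qed

lemma ideal_prod_mono_ideal:
  assumes U: "upclosed U" and V: "upclosed V"
  shows "mono_ideal n U \<cdot>\<^bsub>poly_ring n\<^esub> mono_ideal n V =
    (mono_ideal n (\<lambda>u. \<exists>v w. U v \<and> V w \<and> u = v + w) :: 'k::field mpoly set)" (is "?I = mono_ideal n ?W")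
proof
  interpret R: cring "poly_ring n :: 'k mpoly ring" by (rule cring_poly_ring)
  show "?I \<subseteq> mono_ideal n ?W"
  proof
    fix f :: "'k mpoly" assume "f \<in> ?I"
    then show "f \<in> mono_ideal n ?W"
    proof (induction rule: ideal_prod.induct)
      case (prod i j)
      show ?case
        unfolding mono_ideal_def
      proof (intro CollectI ballI)
        fix u assume "u \<in> keys (i \<otimes>\<^bsub>poly_ring n\<^esub> j)"
        then obtain v w where "v \<in> keys i" "w \<in> keys j" "u = v + w" by (auto elim: in_keys_multE)
        then show "keys u \<subseteq> {1..n} \<and> ?W u"
          using prod by (auto simp: mono_ideal_def keys_add_nat)
      qed
    qed (auto intro: mono_ideal_add)
  qed
  have I: "ideal ?I (poly_ring n)"
    by (intro R.ideal_prod_is_ideal ideal_mono_ideal U V)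
  show "mono_ideal n ?W \<subseteq> ?I"
  proof
    fix f :: "'k mpoly" assume f: "f \<in> mono_ideal n ?W"
    show "f \<in> ?I"
    proof (rule mem_ideal_if_terms[OF I])
      fix u assume "u \<in> keys f"
      then obtain v w where u: "U v" "V w" "u = v + w" "keys u \<subseteq> {1..n}"
        using f by (auto simp: mono_ideal_def)
      have "(monomial v :: 'k mpoly) \<otimes>\<^bsub>poly_ring n\<^esub> monomial w \<in> ?I"
        using u by (intro ideal_prod.prod) (auto simp: keys_add_nat)
      then show "monomial u \<in> ?I" using u by (simp add: monomial_def mult_single)
    qed
  qed
qed

subsection \<open>Primary monomial ideals\<close>

text \<open>For upward closed predicates, this expresses that the ideal is extended from the polynomial ring in the variables with
index in \<open>S\<close>.\<close>

definition depends_on :: "nat set \<Rightarrow> ((nat \<Rightarrow>\<^sub>0 nat) \<Rightarrow> bool) \<Rightarrow> bool" where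
  "depends_on S U \<longleftrightarrow> (\<forall>u v. (\<forall>i\<in>S. lookup u i = lookup v i) \<longrightarrow> U u = U v)"

lemma depends_onD: "depends_on S U \<Longrightarrow> (\<And>i. i \<in> S \<Longrightarrow> lookup u i = lookup v i) \<Longrightarrow> U u = U v"
  unfolding depends_on_def by blast

definition var_ideal :: "nat \<Rightarrow> nat set \<Rightarrow> 'k::field mpoly set" where
  "var_ideal n S = mono_ideal n (\<lambda>u. \<exists>i\<in>S. lookup u i \<noteq> 0)"

definition filter_terms :: "((nat \<Rightarrow>\<^sub>0 nat) \<Rightarrow> bool) \<Rightarrow> 'k::field mpoly \<Rightarrow> 'k mpoly" where
  "filter_terms Q f = (\<Sum>u | u \<in> keys f \<and> Q u. Poly_Mapping.single u (lookup f u))"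

lemma lookup_filter_terms: "lookup (filter_terms Q f) v = (if Q v then lookup f v else 0)"
proof -
  have "lookup (filter_terms Q f) v = (\<Sum>u | u \<in> keys f \<and> Q u. if u = v then lookup f v else 0)"
    unfolding filter_terms_def lookup_sum by (intro sum.cong) (auto simp: lookup_single when_def)
  also have "\<dots> = (if Q v then lookup f v else 0)" by (auto simp: in_keys_iff)
  finally show ?thesis .
qed

lemma keys_filter_terms: "keys (filter_terms Q f) = {u \<in> keys f. Q u}"
  by (auto simp: in_keys_iff lookup_filter_terms split: if_splits)

lemma keys_diff_filter_terms: "keys (f - filter_terms Q f) = {u \<in> keys f. \<not> Q u}"
  by (auto simp: in_keys_iff lookup_filter_terms lookup_minus split: if_splits)

text \<open>A monomial ideal in the variables from \<open>S\<close> has no zero divisors modulo it outside \<open>(x\<^sub>i | i \<in> S)\<close>.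
Among the terms of \<open>f\<close> outside the ideal, collect in \<open>f0\<close> those of least degree in the
variables from \<open>S\<close>; let \<open>g0\<close> be the part of \<open>g\<close> of degree zero in them. The product \<open>g0 f0\<close> is nonzero, and none of
its terms is cancelled in \<open>g f\<close>: a term of \<open>f\<close> that contributes to the same monomial lies outside the ideal as
well and has no larger degree, so it belongs to \<open>f0\<close> and its cofactor to \<open>g0\<close>.\<close>

lemma mono_ideal_primary:
  fixes f g :: "'k::field mpoly"
  assumes U: "upclosed U" "depends_on S U" and S: "finite S"
    and f: "f \<in> mono_ideal n (\<lambda>_. True)" and g: "g \<in> mono_ideal n (\<lambda>_. True)" "g \<notin> var_ideal n S"
    and gf: "g * f \<in> mono_ideal n U"
  shows "f \<in> mono_ideal n U"
proof (rule ccontr)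
  assume "f \<notin> mono_ideal n U"
  define sdeg where "sdeg u = (\<Sum>i\<in>S. lookup u i)" for u :: "nat \<Rightarrow>\<^sub>0 nat"
  have sdeg_add: "sdeg (u + v) = sdeg u + sdeg v" for u v
    by (simp add: sdeg_def lookup_add sum.distrib)
  have sdeg_0: "sdeg u = 0 \<longleftrightarrow> (\<forall>i\<in>S. lookup u i = 0)" for u
    using S by (simp add: sdeg_def)
  have "\<exists>u. u \<in> keys f \<and> \<not> U u"
    using \<open>f \<notin> mono_ideal n U\<close> f by (auto simp: mono_ideal_def)
  then obtain u0 where u0: "u0 \<in> keys f" "\<not> U u0"
    and min: "\<And>u. u \<in> keys f \<Longrightarrow> \<not> U u \<Longrightarrow> sdeg u0 \<le> sdeg u"
    using ex_has_least_nat[of "\<lambda>u. u \<in> keys f \<and> \<not> U u" _ sdeg] by metis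
  obtain v0 where v0: "v0 \<in> keys g" "sdeg v0 = 0"
    using g unfolding var_ideal_def mono_ideal_def sdeg_0 by auto
  define f0 where "f0 = filter_terms (\<lambda>u. \<not> U u \<and> sdeg u = sdeg u0) f"
  define g0 where "g0 = filter_terms (\<lambda>u. sdeg u = 0) g"
  have "u0 \<in> keys f0" "v0 \<in> keys g0" using u0 v0 by (auto simp: f0_def g0_def keys_filter_terms)
  then have "g0 * f0 \<noteq> 0" by (metis keys_zero empty_iff mult_eq_0_iff)
  then obtain u where u: "u \<in> keys (g0 * f0)" by (metis keys_eq_empty ex_in_conv)
  then obtain v w where vw: "v \<in> keys g0" "w \<in> keys f0" "u = v + w" by (rule in_keys_multE)
  have w: "w \<in> keys f" "\<not> U w" "sdeg w = sdeg u0" using vw by (auto simp: f0_def keys_filter_terms)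
  have v: "v \<in> keys g" "sdeg v = 0" using vw by (auto simp: g0_def keys_filter_terms)
  have same: "U (v' + w') = U w'" if "sdeg v' = 0" for v' w'
    using that by (intro depends_onD[OF U(2)]) (auto simp: sdeg_0 lookup_add)
  have notU: "\<not> U u" using same v w vw by simp
  have su: "sdeg u = sdeg u0" using v w vw by (simp add: sdeg_add)
  have 1: "u \<notin> keys (g0 * (f - f0))"
  proof
    assume "u \<in> keys (g0 * (f - f0))"
    then obtain v' w' where *: "v' \<in> keys g0" "w' \<in> keys (f - f0)" "u = v' + w'" by (rule in_keys_multE)
    have v': "sdeg v' = 0" using * by (auto simp: g0_def keys_filter_terms)
    then have "sdeg w' = sdeg u0" using su * by (simp add: sdeg_add)
    moreover have "\<not> U w'" using notU * same[OF v'] by simp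
    ultimately show False using * by (auto simp: f0_def keys_diff_filter_terms)
  qed
  have 2: "u \<notin> keys ((g - g0) * f)"
  proof
    assume "u \<in> keys ((g - g0) * f)"
    then obtain v' w' where *: "v' \<in> keys (g - g0)" "w' \<in> keys f" "u = v' + w'" by (rule in_keys_multE)
    have "sdeg v' \<noteq> 0" using * by (auto simp: g0_def keys_diff_filter_terms)
    then have "sdeg w' < sdeg u0" using su * by (simp add: sdeg_add)
    moreover have "\<not> U w'" using notU * upclosedD[OF U(1), of w' v'] by (auto simp: add.commute)
    ultimately show False using min[of w'] * by auto
  qed
  have "g * f = g0 * f0 + g0 * (f - f0) + (g - g0) * f" by (simp add: algebra_simps)
  then have "lookup (g * f) u = lookup (g0 * f0) u"
    using 1 2 by (simp add: lookup_add in_keys_iff)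
  then have "u \<in> keys (g * f)" using u by (simp add: in_keys_iff)
  then show False using gf notU by (auto simp: mono_ideal_def)
qed

lemma upclosed_var: "upclosed (\<lambda>u. \<exists>i\<in>S. lookup u i \<noteq> 0)"
  by (auto simp: upclosed_def lookup_add)

lemma depends_on_var: "depends_on S (\<lambda>u. \<exists>i\<in>S. lookup u i \<noteq> 0)"
  by (auto simp: depends_on_def)

lemma var_ideal_subset_carrier: "var_ideal n S \<subseteq> mono_ideal n (\<lambda>_. True)"
  unfolding var_ideal_def by (rule mono_ideal_subset_carrier)

lemma ideal_var_ideal: "ideal (var_ideal n S) (poly_ring n)"
  unfolding var_ideal_def by (rule ideal_mono_ideal[OF upclosed_var])

text \<open>Primality is the case of \<open>mono_ideal_primary\<close> in which the monomial ideal is \<open>(x\<^sub>i | i \<in> S)\<close> itself.\<close>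

lemma primeideal_var_ideal:
  assumes "finite S"
  shows "primeideal (var_ideal n S) (poly_ring n :: 'k::field mpoly ring)"
proof (rule primeidealI[OF ideal_var_ideal cring_poly_ring])
  have "1 \<in> carrier (poly_ring n :: 'k mpoly ring)" by (simp add: carrier_poly_ring)
  moreover have "1 \<notin> (var_ideal n S :: 'k mpoly set)" by (simp add: var_ideal_def)
  ultimately show "carrier (poly_ring n) \<noteq> (var_ideal n S :: 'k mpoly set)" by metis
  show "a \<in> var_ideal n S \<or> b \<in> var_ideal n S"
    if "a \<in> carrier (poly_ring n)" "b \<in> carrier (poly_ring n)" "a \<otimes>\<^bsub>poly_ring n\<^esub> b \<in> var_ideal n S"
    for a b :: "'k mpoly"
    using mono_ideal_primary[OF upclosed_var depends_on_var assms, where g = a and f = b and n = n] that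
    unfolding carrier_poly_ring var_ideal_def by auto
qed

lemma var_in_mono_ideal: "(var i :: 'k::field mpoly) \<in> mono_ideal n U \<longleftrightarrow>
    i \<in> {1..n} \<and> U (Poly_Mapping.single i 1)"
  by (auto simp: var_def)

lemma var_in_var_ideal [simp]: "(var i :: 'k::field mpoly) \<in> var_ideal n S \<longleftrightarrow> i \<in> {1..n} \<and> i \<in> S"
  by (auto simp: var_ideal_def var_in_mono_ideal lookup_single when_def)

lemma add_split_single:
  fixes u :: "nat \<Rightarrow>\<^sub>0 nat"
  assumes "\<And>i. lookup g i \<le> lookup u i"
  shows "\<exists>v. u = g + v"
proof -
  have "u = g + (u - g)"
    by (rule poly_mapping_eqI) (use assms in \<open>simp add: lookup_add lookup_minus\<close>)
  then show ?thesis by blast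
qed

lemma le_iff_ex_add:
  fixes g u :: "nat \<Rightarrow>\<^sub>0 nat"
  shows "(\<exists>v. u = g + v) \<longleftrightarrow> (\<forall>i. lookup g i \<le> lookup u i)"
  using add_split_single[of g u] by (auto simp: lookup_add)

lemma Idl_vars:
  assumes "S \<subseteq> {1..n}"
  shows "Idl\<^bsub>poly_ring n\<^esub> (var ` S) = (var_ideal n S :: 'k::field mpoly set)"
proof -
  have "var ` S = (monomial ` ((\<lambda>i. Poly_Mapping.single i 1) ` S) :: 'k mpoly set)"
    by (auto simp: var_def)
  also have "Idl\<^bsub>poly_ring n\<^esub> \<dots> = (mono_ideal n
      (\<lambda>u. \<exists>g\<in>(\<lambda>i. Poly_Mapping.single i 1) ` S. \<exists>v. u = g + v) :: 'k mpoly set)"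
    using assms by (intro Idl_monomials) auto
  also have "(\<lambda>u. \<exists>g\<in>(\<lambda>i. Poly_Mapping.single i 1) ` S. \<exists>v. u = g + v) =
      (\<lambda>u. \<exists>i\<in>S. lookup u i \<noteq> (0 :: nat))"
    unfolding le_iff_ex_add by (force simp: lookup_single when_def fun_eq_iff)
  finally show ?thesis by (simp add: var_ideal_def)
qed

lemma var_ideal_subset_iff:
  assumes "ideal P (poly_ring n)" "S \<subseteq> {1..n}"
  shows "(var_ideal n S :: 'k::field mpoly set) \<subseteq> P \<longleftrightarrow> var ` S \<subseteq> P"
proof
  assume "var_ideal n S \<subseteq> P"
  then show "var ` S \<subseteq> P" using assms(2) by fastforce
next
  interpret R: cring "poly_ring n :: 'k mpoly ring" by (rule cring_poly_ring)
  assume "var ` S \<subseteq> P"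
  then show "var_ideal n S \<subseteq> P" unfolding Idl_vars[OF assms(2), symmetric]
    by (rule R.genideal_minimal[OF assms(1)])
qed

lemma var_ideal_eq_iff:
  assumes "S \<subseteq> {1..n}" "T \<subseteq> {1..n}"
  shows "(var_ideal n S :: 'k::field mpoly set) = var_ideal n T \<longleftrightarrow> S = T"
proof
  assume eq: "(var_ideal n S :: 'k mpoly set) = var_ideal n T"
  have "i \<in> S \<longleftrightarrow> i \<in> T" if "i \<in> {1..n}" for i
    using var_in_var_ideal[of i n S, where 'k = 'k] var_in_var_ideal[of i n T, where 'k = 'k] eq that by simp
  then show "S = T" using assms by blast
qed simp

lemma homogeneous_var_ideal:
  assumes "S \<subseteq> {1..n}"
  shows "homogeneous_ideal n (var_ideal n S :: 'k::field mpoly set)"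
  unfolding homogeneous_ideal_def
proof
  interpret R: cring "poly_ring n :: 'k mpoly ring" by (rule cring_poly_ring)
  show id: "ideal (var_ideal n S :: 'k mpoly set) (poly_ring n)" by (rule ideal_var_ideal)
  let ?H = "{f \<in> var_ideal n S. \<exists>d. f \<in> (homogeneous_part n d :: 'k mpoly set)}"
  have carr: "?H \<subseteq> carrier (poly_ring n)"
    using var_ideal_subset_carrier by (auto simp: carrier_poly_ring)
  have "var ` S \<subseteq> ?H"
  proof
    fix f :: "'k mpoly" assume "f \<in> var ` S"
    then obtain i where i: "i \<in> S" "f = var i" by blast
    then have "i \<in> {1..n}" using assms by blast
    then have "var i \<in> (homogeneous_part n 1 :: 'k mpoly set)"
      by (auto simp: homogeneous_part_def carrier_poly_ring var_in_mono_ideal var_def total_degree_def)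
    then show "f \<in> ?H" using i \<open>i \<in> {1..n}\<close> by auto
  qed
  then have "Idl\<^bsub>poly_ring n\<^esub> (var ` S) \<subseteq> Idl\<^bsub>poly_ring n\<^esub> ?H"
    by (rule R.subset_Idl_subset[OF carr])
  then show "var_ideal n S = Idl\<^bsub>poly_ring n\<^esub> ?H"
    unfolding Idl_vars[OF assms] using R.genideal_minimal[OF id, of ?H] by auto
qed

lemma lookup_sum_single:
  assumes "finite T"
  shows "lookup (\<Sum>j\<in>T. Poly_Mapping.single j (c :: nat)) i = (if i \<in> T then c else 0)"
  using assms by (simp add: lookup_sum lookup_single when_def)

section \<open>Multiplicities of intersections of primary monomial ideals\<close>

text \<open>An intersection of monomial ideals, where the component with index \<open>S\<close> is defined by the exponents of the
variables in \<open>S\<close> and contains the squares of these variables. A proper component is therefore primary to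
\<open>(x\<^sub>i | i \<in> S)\<close>.\<close>

locale square_components =
  fixes n :: nat and F :: "nat set set" and U :: "nat set \<Rightarrow> (nat \<Rightarrow>\<^sub>0 nat) \<Rightarrow> bool"
  assumes F: "\<And>S. S \<in> F \<Longrightarrow> S \<subseteq> {1..n}"
    and up: "\<And>S. S \<in> F \<Longrightarrow> upclosed (U S)"
    and dep: "\<And>S. S \<in> F \<Longrightarrow> depends_on S (U S)"
    and square: "\<And>S u i. S \<in> F \<Longrightarrow> i \<in> S \<Longrightarrow> lookup u i \<ge> 2 \<Longrightarrow> U S u"
begin

definition Q :: "'k::field mpoly set" where
  "Q = mono_ideal n (\<lambda>u. \<forall>S\<in>F. U S u)"

lemma upclosed_Ball: "upclosed (\<lambda>u. \<forall>S\<in>F. X S \<longrightarrow> U S u)"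
  using up by (auto simp: upclosed_def)

lemma ideal_Q: "ideal Q (poly_ring n)"
  unfolding Q_def using upclosed_Ball[of "\<lambda>_. True"] by (intro ideal_mono_ideal) simp

lemma finite_S: "S \<in> F \<Longrightarrow> finite S"
  using F finite_subset by blast

lemma prime_localization_Q:
  assumes "primeideal P (poly_ring n)"
  shows "prime_localization (carrier (poly_ring n)) P (Q :: 'k::field mpoly set)"
  using assms ideal_Q
  by (intro prime_localization.intro) (simp_all flip: poly_ring_eq add: cring_poly_ring)

lemma component_cancel:
  fixes f g :: "'k::field mpoly"
  assumes "S \<in> F" "f \<in> carrier (poly_ring n)" "g \<in> carrier (poly_ring n)" "g \<notin> var_ideal n S"
    "g * f \<in> mono_ideal n (U S)"
  shows "f \<in> mono_ideal n (U S)"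
  using mono_ideal_primary[OF up dep finite_S] assms by (simp add: carrier_poly_ring)

lemma Q_subset_component: "S \<in> F \<Longrightarrow> Q \<subseteq> mono_ideal n (U S)"
  unfolding Q_def by (rule mono_ideal_mono) simp

lemma mem_mono_ideal_Ball:
  assumes "f \<in> carrier (poly_ring n)" "\<And>S. S \<in> F \<Longrightarrow> X S \<Longrightarrow> f \<in> mono_ideal n (U S)"
  shows "f \<in> mono_ideal n (\<lambda>u. \<forall>S\<in>F. X S \<longrightarrow> U S u)"
  using assms by (auto simp: mono_ideal_def carrier_poly_ring)

lemma prod_vars:
  assumes "finite T"
  shows "(\<Prod>j\<in>T. var j * var j :: 'k::field mpoly) = monomial (\<Sum>j\<in>T. Poly_Mapping.single j 2)"
  using assms
proof (induction T)
  case (insert j T)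
  have "(var j * var j :: 'k mpoly) = monomial (Poly_Mapping.single j 2)"
    by (simp add: var_def monomial_def mult_single numeral_2_eq_2 flip: single_add)
  then show ?case using insert by (simp add: monomial_def mult_single)
qed (simp add: monomial_def)

text \<open>Localizing at \<open>P\<close> keeps exactly the components whose variables lie in \<open>P\<close>. The other
components all contain the product of the squares of the variables outside \<open>P\<close>, which is a unit in
the localization; the surviving ones are not enlarged, because elements outside \<open>P\<close> can be cancelled
modulo them.\<close>

lemma sat_Q:
  assumes P: "primeideal P (poly_ring n)"
  shows "prime_localization.sat (carrier (poly_ring n)) P (Q :: 'k::field mpoly set) =
    mono_ideal n (\<lambda>u. \<forall>S\<in>F. var ` S \<subseteq> P \<longrightarrow> U S u)" (is "?sat = ?K")
proof -
  interpret prime_localization "carrier (poly_ring n)" P "Q :: 'k mpoly set"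
    by (rule prime_localization_Q[OF P])
  have Pid: "ideal P (poly_ring n)" by (rule primeideal.axioms(1)[OF P])
  show ?thesis
  proof
    show "?sat \<subseteq> ?K"
    proof
      fix f assume "f \<in> ?sat"
      then obtain t where t: "t \<in> carrier (poly_ring n) - P" "t * f \<in> Q" "f \<in> carrier (poly_ring n)"
        by (auto simp: sat_def)
      show "f \<in> ?K"
      proof (rule mem_mono_ideal_Ball[OF t(3)])
        fix S assume S: "S \<in> F" "var ` S \<subseteq> P"
        then have "t \<notin> var_ideal n S" using var_ideal_subset_iff[OF Pid F[OF S(1)]] t by auto
        then show "f \<in> mono_ideal n (U S)"
          using component_cancel[OF S(1) t(3)] t Q_subset_component[OF S(1)] by blast
      qed
    qed
    show "?K \<subseteq> ?sat"
    proof
      fix f :: "'k mpoly" assume f: "f \<in> ?K"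
      then have fC: "f \<in> carrier (poly_ring n)"
        using mono_ideal_subset_carrier carrier_poly_ring by blast
      define T where "T = {j \<in> {1..n}. var j \<notin> P}"
      have T: "finite T" by (simp add: T_def)
      define t :: "'k mpoly" where "t = (\<Prod>j\<in>T. var j * var j)"
      have tm: "t = monomial (\<Sum>j\<in>T. Poly_Mapping.single j 2)" (is "_ = monomial ?w")
        unfolding t_def by (rule prod_vars[OF T])
      have w: "lookup ?w i = (if i \<in> T then 2 else 0)" for i by (rule lookup_sum_single[OF T])
      have "(\<Prod>j\<in>X. var j * var j) \<in> carrier (poly_ring n) - P" if "X \<subseteq> T" for X
        using finite_subset[OF that T] that
      proof (induction X)
        case empty
        then show ?case using one_in_S by simp
      next
        case (insert j X)
        then have "var j \<in> carrier (poly_ring n) - P"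
          by (auto simp: T_def carrier_poly_ring var_in_mono_ideal)
        then show ?case using insert mult_in_S by simp
      qed
      from this[of T] have tC: "t \<in> carrier (poly_ring n) - P" by (simp add: t_def)
      have "t * f \<in> Q"
        unfolding Q_def mono_ideal_def
      proof (intro CollectI ballI conjI)
        fix u assume "u \<in> keys (t * f)"
        then obtain v where v: "v \<in> keys f" "u = ?w + v" by (auto elim!: in_keys_multE simp: tm)
        have "keys ?w \<subseteq> {1..n}" by (auto simp: in_keys_iff w split: if_splits) (auto simp: T_def)
        moreover have fv: "keys v \<subseteq> {1..n}" "\<And>S. S \<in> F \<Longrightarrow> var ` S \<subseteq> P \<Longrightarrow> U S v"
          using f v by (auto simp: mono_ideal_def)
        ultimately show "keys u \<subseteq> {1..n}" by (simp add: v keys_add_nat)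
        fix S assume S: "S \<in> F"
        show "U S u"
        proof (cases "var ` S \<subseteq> P")
          case True
          then show ?thesis using fv(2)[OF S] upclosedD[OF up[OF S], of v ?w] by (simp add: v add.commute)
        next
          case False
          then obtain j where "j \<in> S" "j \<in> T" using F[OF S] unfolding T_def by blast
          then show ?thesis by (intro square[OF S, of j]) (auto simp: v lookup_add w)
        qed
      qed
      then show "f \<in> ?sat" using fC tC by (auto simp: sat_def)
    qed
  qed
qed

text \<open>If \<open>(x\<^sub>i | i \<in> S)\<close> is strictly smaller than \<open>P\<close>, then powers of some \<open>p \<in> P\<close> can be cancelled modulo the
component of \<open>S\<close>; so what is killed by powers of all elements of \<open>P\<close> lies in that component.\<close>

lemma component_if_annihilated:
  assumes P: "primeideal P (poly_ring n)" and S: "S \<in> F" "var ` S \<subseteq> P" "P \<noteq> var_ideal n S"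
    and f: "f \<in> carrier (poly_ring n)"
    and ann: "\<And>p. p \<in> P \<Longrightarrow> \<exists>k. p ^ k * f \<in> prime_localization.sat (carrier (poly_ring n)) P (Q :: 'k::field mpoly set)"
  shows "f \<in> mono_ideal n (U S)"
proof -
  interpret prime_localization "carrier (poly_ring n)" P "Q :: 'k mpoly set"
    by (rule prime_localization_Q[OF P])
  interpret V: prime_localization "carrier (poly_ring n)" "var_ideal n S" "Q :: 'k mpoly set"
    by (rule prime_localization_Q[OF primeideal_var_ideal[OF finite_S[OF S(1)]]])
  have Pid: "ideal P (poly_ring n)" by (rule primeideal.axioms(1)[OF P])
  have "var_ideal n S \<subseteq> P" using var_ideal_subset_iff[OF Pid F[OF S(1)]] S by simp
  then obtain p where p: "p \<in> P" "p \<notin> var_ideal n S" using S(3) by blast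
  have pC: "p \<in> carrier (poly_ring n)" using P_ideal'(1) p by blast
  obtain k where k: "p ^ k * f \<in> sat" using ann[OF p(1)] by blast
  have "p ^ k \<in> carrier (poly_ring n) - var_ideal n S"
    by (induction k) (use p pC V.one_in_S V.mult_in_S in auto)
  moreover have "p ^ k * f \<in> mono_ideal n (U S)"
    using k S unfolding sat_Q[OF P] by (auto simp: mono_ideal_def)
  ultimately show ?thesis using component_cancel[OF S(1) f, of "p ^ k"] by blast
qed

lemma mult_at_eq_length:
  assumes P: "primeideal P (poly_ring n)"
  shows "mult_at n Q P = the_enat (ideal_length (prime_localization.A (carrier (poly_ring n)) P (Q :: 'k::field mpoly set))
     (largest_finite_length_ideal (prime_localization.A (carrier (poly_ring n)) P Q)))"
  unfolding mult_at_def Let_def prime_localization.A_def[OF prime_localization_Q[OF P]]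
  by (simp flip: poly_ring_eq)

text \<open>By \<open>component_if_annihilated\<close>, elements of ideals of finite length lie in every component that survives the
localization; so the zero ideal is the only ideal of finite length, whether \<open>P\<close> is a monomial ideal or not.\<close>

lemma mult_at_other_prime:
  assumes P: "primeideal P (poly_ring n)" and other: "\<And>S. S \<in> F \<Longrightarrow> P \<noteq> var_ideal n S"
  shows "mult_at n (Q :: 'k::field mpoly set) P = 0"
proof -
  interpret prime_localization "carrier (poly_ring n)" P "Q :: 'k mpoly set"
    by (rule prime_localization_Q[OF P])
  have id: "ideal sat (poly_ring n)"
    unfolding sat_Q[OF P] by (intro ideal_mono_ideal upclosed_Ball)
  have "the_enat (ideal_length A (largest_finite_length_ideal A)) = 0"
  proof (rule multiplicity_by_filtration[where K = "\<lambda>_. sat" and r = 0])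
    have "Q \<subseteq> sat"
    proof
      fix f assume "f \<in> (Q :: 'k mpoly set)"
      then show "f \<in> sat" using I_ideal(1) one_in_S unfolding sat_def by force
    qed
    moreover have "f \<in> sat" if f: "f \<in> carrier (poly_ring n)" "t \<in> carrier (poly_ring n) - P" "t * f \<in> sat" for f t
    proof -
      obtain s where "s \<in> carrier (poly_ring n) - P" "s * (t * f) \<in> Q" using f(3) by (auto simp: sat_def)
      then have "s * t \<in> carrier (poly_ring n) - P" "(s * t) * f \<in> Q"
        using mult_in_S f by (auto simp: mult.assoc)
      then show ?thesis using f unfolding sat_def by blast
    qed
    ultimately show "saturated sat" unfolding saturated_def using id by (simp flip: poly_ring_eq)
    fix f assume f: "f \<in> carrier (poly_ring n)" "\<And>p. p \<in> P \<Longrightarrow> \<exists>k. p ^ k * f \<in> sat"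
    show "f \<in> sat"
      unfolding sat_Q[OF P]
      by (intro mem_mono_ideal_Ball[OF f(1)] component_if_annihilated[OF P _ _ _ f] other)
  qed auto
  then show ?thesis by (simp add: mult_at_eq_length[OF P])
qed

text \<open>The filtration criterion for monomial ideals: all its conditions become conditions on exponent vectors. The
predicate \<open>V 0\<close> collects the components that survive the localization at \<open>(x\<^sub>i | i \<in> S0)\<close>, and \<open>V r\<close> must be
implied by those whose index is strictly smaller than \<open>S0\<close>.\<close>

lemma mult_at_component:
  fixes V :: "nat \<Rightarrow> (nat \<Rightarrow>\<^sub>0 nat) \<Rightarrow> bool" and g :: "nat \<Rightarrow> (nat \<Rightarrow>\<^sub>0 nat)"
  assumes S: "S0 \<subseteq> {1..n}"
    and V0: "\<And>u. V 0 u \<longleftrightarrow> (\<forall>S\<in>F. S \<subseteq> S0 \<longrightarrow> U S u)"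
    and V: "\<And>l. l \<le> r \<Longrightarrow> upclosed (V l)" "\<And>l. l \<le> r \<Longrightarrow> depends_on S0 (V l)"
    and g: "\<And>l. l < r \<Longrightarrow> keys (g l) \<subseteq> {1..n}" "\<And>l. l < r \<Longrightarrow> V (Suc l) (g l)" "\<And>l. l < r \<Longrightarrow> \<not> V l (g l)"
    and mono: "\<And>l u. l < r \<Longrightarrow> V l u \<Longrightarrow> V (Suc l) u"
    and gen: "\<And>l u. l < r \<Longrightarrow> V (Suc l) u \<Longrightarrow> V l u \<or> (\<exists>v. u = g l + v)"
    and ann: "\<And>l i. l < r \<Longrightarrow> i \<in> S0 \<Longrightarrow> V l (g l + Poly_Mapping.single i 1)"
    and top: "\<And>u. (\<And>S. S \<in> F \<Longrightarrow> S \<subset> S0 \<Longrightarrow> U S u) \<Longrightarrow> V r u"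
  shows "mult_at n (Q :: 'k::field mpoly set) (var_ideal n S0) = r"
proof -
  have fin: "finite S0" using S finite_subset by blast
  let ?P = "var_ideal n S0 :: 'k mpoly set"
  have P: "primeideal ?P (poly_ring n)" by (rule primeideal_var_ideal[OF fin])
  interpret prime_localization "carrier (poly_ring n)" ?P "Q :: 'k mpoly set"
    by (rule prime_localization_Q[OF P])
  have varS: "var ` S \<subseteq> ?P \<longleftrightarrow> S \<subseteq> S0" if "S \<in> F" for S
    using F[OF that] by (auto simp: subset_iff)
  have sat: "sat = mono_ideal n (V 0)"
  proof -
    have "(\<lambda>u. \<forall>S\<in>F. var ` S \<subseteq> ?P \<longrightarrow> U S u) = V 0" using V0 varS by auto
    then show ?thesis using sat_Q[OF P] by simp
  qed
  have V0l: "V l u" if "V 0 u" "l \<le> r" for l u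
    using that(2) by (induction l) (use that(1) mono in auto)
  have "the_enat (ideal_length A (largest_finite_length_ideal A)) = r"
  proof (rule multiplicity_by_filtration[where K = "\<lambda>l. mono_ideal n (V l)" and g = "\<lambda>l. monomial (g l)"])
    show "mono_ideal n (V 0) \<subseteq> sat" by (simp add: sat)
    show "saturated (mono_ideal n (V l))" if l: "l \<le> r" for l
      unfolding saturated_def
    proof (intro conjI ballI impI)
      show "ideal (mono_ideal n (V l) :: 'k mpoly set) (ambient_subring (carrier (poly_ring n)))"
        using ideal_mono_ideal[OF V(1)[OF l]] by (simp flip: poly_ring_eq)
      show "Q \<subseteq> (mono_ideal n (V l) :: 'k mpoly set)"
        unfolding Q_def using V0 V0l[OF _ l] by (intro mono_ideal_mono) blast
      show "f \<in> mono_ideal n (V l)" if "f \<in> carrier (poly_ring n)" "t \<in> carrier (poly_ring n) - ?P"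
          "t * f \<in> mono_ideal n (V l)" for f t :: "'k mpoly"
        using mono_ideal_primary[OF V(1,2)[OF l] fin, of f n t] that by (simp add: carrier_poly_ring)
    qed
    show "monomial (g l) \<in> mono_ideal n (V (Suc l)) - (mono_ideal n (V l) :: 'k mpoly set)" if "l < r" for l
      using g[OF that] by simp
    show "mono_ideal n (V l) \<subseteq> (mono_ideal n (V (Suc l)) :: 'k mpoly set)" if "l < r" for l
      by (rule mono_ideal_mono) (rule mono[OF that])
    show "\<exists>u\<in>carrier (poly_ring n). f - u * monomial (g l) \<in> mono_ideal n (V l)"
      if l: "l < r" and f: "f \<in> mono_ideal n (V (Suc l))" for l and f :: "'k mpoly"
    proof -
      \<comment> \<open>The terms of \<open>f\<close> outside \<open>V l\<close> are divisible by the monomial with exponent \<open>g l\<close>; their quotients form \<open>h\<close>.\<close>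
      define B where "B = {u \<in> keys f. \<not> V l u}"
      define h :: "'k mpoly" where "h = (\<Sum>u\<in>B. Poly_Mapping.single (u - g l) (lookup f u))"
      have B: "finite B" by (simp add: B_def)
      have ug: "u - g l + g l = u" "keys (u - g l) \<subseteq> {1..n}" if u: "u \<in> B" for u
      proof -
        have "V (Suc l) u" "\<not> V l u" "keys u \<subseteq> {1..n}" using f u by (auto simp: B_def mono_ideal_def)
        then obtain v where "u = g l + v" using gen[OF l] by blast
        then show "u - g l + g l = u" "keys (u - g l) \<subseteq> {1..n}"
          using \<open>keys u \<subseteq> {1..n}\<close> by (auto simp: keys_add_nat add.commute)
      qed
      have "h * monomial (g l) = (\<Sum>u\<in>B. Poly_Mapping.single u (lookup f u))"
        unfolding h_def sum_distrib_right monomial_def mult_single using ug(1) by (intro sum.cong) auto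
      also have "\<dots> = filter_terms (\<lambda>u. \<not> V l u) f" by (simp add: filter_terms_def B_def)
      finally have "f - h * monomial (g l) \<in> mono_ideal n (V l)"
        using f by (auto simp: mono_ideal_def keys_diff_filter_terms)
      moreover have "h \<in> carrier (poly_ring n)"
        unfolding h_def carrier_poly_ring using ug(2)
        by (intro mono_ideal_sum) (auto simp: mono_ideal_def split: if_splits)
      ultimately show ?thesis by blast
    qed
    show "p * monomial (g l) \<in> mono_ideal n (V l)" if l: "l < r" and p: "p \<in> ?P" for l and p :: "'k mpoly"
      unfolding mono_ideal_def
    proof (intro CollectI ballI conjI)
      fix u assume "u \<in> keys (p * monomial (g l))"
      then obtain v where v: "v \<in> keys p" "u = v + g l" by (auto elim!: in_keys_multE)
      then obtain i where i: "i \<in> S0" "lookup v i \<noteq> 0" and kv: "keys v \<subseteq> {1..n}"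
        using p by (auto simp: var_ideal_def mono_ideal_def)
      show "keys u \<subseteq> {1..n}" using kv g(1)[OF l] by (simp add: v keys_add_nat)
      have "\<exists>w. v = Poly_Mapping.single i 1 + w"
        using i by (intro add_split_single) (auto simp: lookup_single when_def)
      then obtain w where "v = Poly_Mapping.single i 1 + w" ..
      then have "u = (g l + Poly_Mapping.single i 1) + w" by (simp add: v ac_simps)
      then show "V l u" using ann[OF l i(1)] upclosedD[OF V(1)] l by simp
    qed
    show "f \<in> mono_ideal n (V r)" if f: "f \<in> carrier (poly_ring n)" "\<And>p. p \<in> ?P \<Longrightarrow> \<exists>k. p ^ k * f \<in> sat"
      for f :: "'k mpoly"
    proof -
      have "f \<in> mono_ideal n (U S)" if "S \<in> F" "S \<subset> S0" for S
      proof (rule component_if_annihilated[OF P that(1) _ _ f])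
        show "var ` S \<subseteq> ?P" using varS that by auto
        show "?P \<noteq> var_ideal n S" using var_ideal_eq_iff[OF S F[OF that(1)]] that by auto
      qed
      then show ?thesis using f(1) top by (auto simp: mono_ideal_def carrier_poly_ring)
    qed
  qed
  then show ?thesis by (simp add: mult_at_eq_length[OF P])
qed

end

section \<open>The degree of a prime generated by variables\<close>

text \<open>Exponent vectors of degree \<open>d\<close> are multisets of size \<open>d\<close>.\<close>

lemma card_exponents_of_degree:
  assumes T: "finite T"
  shows "finite {u. keys u \<subseteq> T \<and> total_degree u = d}"
    and "card {u. keys u \<subseteq> T \<and> total_degree u = d} = (card T + d - 1) choose d"
proof -
  define h where "h X = Abs_poly_mapping (count X)" for X :: "nat multiset"
  have lookup_h: "lookup (h X) = count X" for X by (simp add: h_def)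
  have keys_h: "keys (h X) = set_mset X" for X by (auto simp: in_keys_iff lookup_h)
  have degree_h: "total_degree (h X) = size X" for X
    by (simp add: total_degree_def keys_h lookup_h size_multiset_overloaded_eq)
  have "bij_betw h (multisets_of_size T d) {u. keys u \<subseteq> T \<and> total_degree u = d}"
  proof (rule bij_betw_imageI)
    show "inj_on h (multisets_of_size T d)"
      by (intro inj_onI multiset_eqI) (metis lookup_h)
    show "h ` multisets_of_size T d = {u. keys u \<subseteq> T \<and> total_degree u = d}"
    proof (intro equalityI subsetI)
      fix u assume u: "u \<in> {u. keys u \<subseteq> T \<and> total_degree u = d}"
      have "finite {i. lookup u i > 0}" by simp
      then have "lookup (h (Abs_multiset (lookup u))) = lookup u" by (simp add: lookup_h)
      then have eq: "h (Abs_multiset (lookup u)) = u" unfolding poly_mapping_eq_iff .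
      have "set_mset (Abs_multiset (lookup u)) = keys u" "size (Abs_multiset (lookup u)) = total_degree u"
        unfolding keys_h[symmetric] degree_h[symmetric] eq by (rule refl)+
      then have "Abs_multiset (lookup u) \<in> multisets_of_size T d"
        using u unfolding multisets_of_size_def by blast
      then show "u \<in> h ` multisets_of_size T d" using eq image_iff by metis
    next
      fix u assume "u \<in> h ` multisets_of_size T d"
      then show "u \<in> {u. keys u \<subseteq> T \<and> total_degree u = d}"
        by (auto simp: multisets_of_size_def keys_h degree_h)
    qed
  qed
  then show "finite {u. keys u \<subseteq> T \<and> total_degree u = d}"
    and "card {u. keys u \<subseteq> T \<and> total_degree u = d} = (card T + d - 1) choose d"
    using bij_betw_finite[of h "multisets_of_size T d"] bij_betw_same_card[of h "multisets_of_size T d"]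
      finite_multisets_of_size[OF T] card_multisets_of_size[OF T] by simp_all
qed

text \<open>The classes of the monomials of degree \<open>d\<close> in the variables outside \<open>S\<close> form a basis of the degree \<open>d\<close>
component of the quotient. With no variables outside \<open>S\<close>, the formula uses truncated subtraction: it gives \<open>1\<close> for \<open>d = 0\<close>
and \<open>(d - 1) choose d = 0\<close> for \<open>d > 0\<close>.\<close>

lemma hilbert_function_var_ideal:
  assumes S: "S \<subseteq> {1..n}"
  shows "hilbert_function n (var_ideal n S :: 'k::field mpoly set) d = ((n - card S) + d - 1) choose d"
proof -
  let ?R = "poly_ring n :: 'k mpoly ring"
  let ?P = "var_ideal n S :: 'k mpoly set"
  define Q where "Q = ?R Quot ?P"
  define \<pi> where "\<pi> f = ?P +>\<^bsub>?R\<^esub> f" for f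
  have fin: "finite S" using S finite_subset by blast
  interpret R: cring ?R by (rule cring_poly_ring)
  interpret P: primeideal ?P ?R by (rule primeideal_var_ideal[OF fin])
  interpret Q: "domain" Q unfolding Q_def by (rule P.quotient_is_domain)
  interpret h: ring_hom_ring ?R Q \<pi>
    unfolding \<pi>_def Q_def by (rule P.rcos_ring_hom_ring)
  have carr: "f \<in> carrier ?R \<longleftrightarrow> (\<forall>u\<in>keys f. keys u \<subseteq> {1..n})" for f
    by (simp add: carrier_poly_ring mono_ideal_def)
  have \<pi>_eq: "\<pi> f = \<pi> g \<longleftrightarrow> f - g \<in> ?P" if "f \<in> carrier ?R" "g \<in> carrier ?R" for f g
  proof -
    have "f \<ominus>\<^bsub>?R\<^esub> g = f - g"
      using uminus_in_ambient_subring(2)[OF cring_poly_ring' that(2)]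
      by (simp flip: poly_ring_eq add: a_minus_def)
    then show ?thesis
      using R.quotient_eq_iff_same_a_r_cos[OF P.is_ideal that] by (simp add: \<pi>_def)
  qed
  define K0 :: "'k mpoly set" where "K0 = range (Poly_Mapping.single 0)"
  have constC: "Poly_Mapping.single 0 c \<in> carrier ?R" for c
    by (simp add: carr)
  have "subfield K0 ?R"
  proof (rule R.subfieldI)
    show "subcring K0 ?R"
    proof (rule R.subcringI, rule R.subringI)
      show "\<ominus>\<^bsub>?R\<^esub> h \<in> K0" if "h \<in> K0" for h
      proof -
        obtain c where c: "h = Poly_Mapping.single 0 c" using \<open>h \<in> K0\<close> by (auto simp: K0_def)
        have "\<ominus>\<^bsub>?R\<^esub> h = - h"
          using uminus_in_ambient_subring(2)[OF cring_poly_ring', of h n] constC c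
          by (simp flip: poly_ring_eq)
        then have "\<ominus>\<^bsub>?R\<^esub> h = Poly_Mapping.single 0 (- c)" by (simp add: c single_uminus)
        then show ?thesis by (simp add: K0_def)
      qed
      show "h1 \<otimes>\<^bsub>?R\<^esub> h2 \<in> K0" "h1 \<oplus>\<^bsub>?R\<^esub> h2 \<in> K0" if "h1 \<in> K0" "h2 \<in> K0" for h1 h2
        using that by (auto simp: K0_def mult_single simp flip: single_add)
      show "\<one>\<^bsub>?R\<^esub> \<in> K0" unfolding K0_def by (metis poly_ring_ops(3) rangeI single_one)
      show "h1 \<otimes>\<^bsub>?R\<^esub> h2 = h2 \<otimes>\<^bsub>?R\<^esub> h1" for h1 h2 by simp
    qed (use constC in \<open>auto simp: K0_def\<close>)
    show "Units (?R\<lparr>carrier := K0\<rparr>) = K0 - {\<zero>\<^bsub>?R\<^esub>}"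
    proof
      show "Units (?R\<lparr>carrier := K0\<rparr>) \<subseteq> K0 - {\<zero>\<^bsub>?R\<^esub>}" by (auto simp: Units_def)
      show "K0 - {\<zero>\<^bsub>?R\<^esub>} \<subseteq> Units (?R\<lparr>carrier := K0\<rparr>)"
      proof
        fix h assume "h \<in> K0 - {\<zero>\<^bsub>?R\<^esub>}"
        then obtain c where c: "h = Poly_Mapping.single 0 c" "c \<noteq> 0"
          unfolding K0_def by force
        have "Poly_Mapping.single 0 (inverse c) * h = 1" using c by (simp add: mult_single)
        then show "h \<in> Units (?R\<lparr>carrier := K0\<rparr>)"
          unfolding Units_def using c by (auto simp: K0_def mult.commute intro!: bexI[of _ "Poly_Mapping.single 0 (inverse c)"])
      qed
    qed
  qed
  then have K: "subfield (\<pi> ` K0) Q"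
    by (rule h.img_is_subfield(2)) (rule Q.one_not_zero)
  \<comment> \<open>Elements of the ideal have no term that avoids \<open>S\<close>; hence monomials avoiding \<open>S\<close> stay independent.\<close>
  have avoid: "u \<notin> keys f" if "f \<in> ?P" "\<forall>i\<in>S. lookup u i = 0" for f u
    using that by (auto simp: var_ideal_def mono_ideal_def)
  have dim: "Q.dimension (card B) (\<pi> ` K0) (\<pi> ` {f. keys f \<subseteq> B})"
    if "finite B" "\<And>u. u \<in> B \<Longrightarrow> keys u \<subseteq> {1..n} \<and> (\<forall>i\<in>S. lookup u i = 0)" for B
    using that
  proof (induction B rule: finite_induct)
    case empty
    have "\<pi> 0 = \<zero>\<^bsub>Q\<^esub>" using h.hom_zero by simp
    then show ?case by simp
  next
    case (insert v B)
    let ?E = "\<pi> ` {f. keys f \<subseteq> B}"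
    have BC: "f \<in> carrier ?R" if "keys f \<subseteq> insert v B" for f
      using that insert.prems by (auto simp: carr subset_iff)
    have v: "monomial v \<in> carrier ?R" by (rule BC) simp
    have ext: "\<pi> (Poly_Mapping.single 0 c) \<otimes>\<^bsub>Q\<^esub> \<pi> (monomial v) \<oplus>\<^bsub>Q\<^esub> \<pi> f = \<pi> (Poly_Mapping.single v c + f)"
      if "keys f \<subseteq> insert v B" for c f
    proof -
      have "\<pi> (Poly_Mapping.single 0 c) \<otimes>\<^bsub>Q\<^esub> \<pi> (monomial v) = \<pi> (Poly_Mapping.single v c)"
        using h.hom_mult[OF constC v, of c] by (simp add: single_eq_mult_monomial[of v c])
      moreover have "\<pi> (Poly_Mapping.single v c) \<oplus>\<^bsub>Q\<^esub> \<pi> f = \<pi> (Poly_Mapping.single v c + f)"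
        using h.hom_add[of "Poly_Mapping.single v c" f] BC[OF that] BC[of "Poly_Mapping.single v c"]
        by (simp split: if_splits)
      ultimately show ?thesis by simp
    qed
    have "Q.dimension (Suc (card B)) (\<pi> ` K0) (Q.line_extension (\<pi> ` K0) (\<pi> (monomial v)) ?E)"
    proof (rule Q.Suc_dim)
      show "\<pi> (monomial v) \<in> carrier Q" using h.hom_closed[OF v] .
      show "\<pi> (monomial v) \<notin> ?E"
      proof
        assume "\<pi> (monomial v) \<in> ?E"
        then obtain f where f: "keys f \<subseteq> B" "\<pi> (monomial v) = \<pi> f" by blast
        then have "monomial v - f \<in> ?P" using \<pi>_eq[OF v BC] by auto
        then have "v \<notin> keys (monomial v - f)" using insert.prems by (intro avoid) auto
        moreover have "lookup f v = 0" using f(1) insert.hyps by (auto simp: in_keys_iff)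
        ultimately show False by (simp add: in_keys_iff lookup_minus monomial_def)
      qed
      show "Q.dimension (card B) (\<pi> ` K0) ?E" using insert by simp
    qed
    also have "Q.line_extension (\<pi> ` K0) (\<pi> (monomial v)) ?E = \<pi> ` {f. keys f \<subseteq> insert v B}"
    proof (intro equalityI subsetI)
      fix x assume "x \<in> Q.line_extension (\<pi> ` K0) (\<pi> (monomial v)) ?E"
      then obtain c f where f: "keys f \<subseteq> B"
        "x = \<pi> (Poly_Mapping.single 0 c) \<otimes>\<^bsub>Q\<^esub> \<pi> (monomial v) \<oplus>\<^bsub>Q\<^esub> \<pi> f"
        by (auto simp: Q.line_extension_def set_add_def' r_coset_def K0_def)
      then have "x = \<pi> (Poly_Mapping.single v c + f)" using ext[of f c] by auto
      moreover have "keys (Poly_Mapping.single v c + f) \<subseteq> insert v B"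
        using f(1) keys_add[of "Poly_Mapping.single v c" f] by (auto split: if_splits)
      ultimately show "x \<in> \<pi> ` {f. keys f \<subseteq> insert v B}" by blast
    next
      fix x assume "x \<in> \<pi> ` {f. keys f \<subseteq> insert v B}"
      then obtain f where f: "keys f \<subseteq> insert v B" "x = \<pi> f" by blast
      define g where "g = f - Poly_Mapping.single v (lookup f v)"
      have g: "keys g \<subseteq> B"
        using f(1) by (auto simp: g_def in_keys_iff lookup_minus lookup_single when_def subset_iff split: if_splits)
      have "x = \<pi> (Poly_Mapping.single 0 (lookup f v)) \<otimes>\<^bsub>Q\<^esub> \<pi> (monomial v) \<oplus>\<^bsub>Q\<^esub> \<pi> g"
        using ext[of g "lookup f v"] g f(2) by (auto simp: g_def)
      then show "x \<in> Q.line_extension (\<pi> ` K0) (\<pi> (monomial v)) ?E"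
        using g by (auto simp: Q.line_extension_def set_add_def' r_coset_def K0_def)
    qed
    finally show ?case using insert.hyps by simp
  qed
  define B where "B = {u. keys u \<subseteq> {1..n} - S \<and> total_degree u = d}"
  have B: "finite B" "card B = ((n - card S) + d - 1) choose d"
    using card_exponents_of_degree[of "{1..n} - S" d] S fin
    by (auto simp: B_def card_Diff_subset)
  have "\<pi> ` homogeneous_part n d = \<pi> ` {f. keys f \<subseteq> B}"
  proof (intro equalityI subsetI)
    fix x assume "x \<in> \<pi> ` homogeneous_part n d"
    then obtain f where f: "f \<in> homogeneous_part n d" "x = \<pi> f" by blast
    define g where "g = filter_terms (\<lambda>u. \<forall>i\<in>S. lookup u i = 0) f"
    have fC: "f \<in> carrier ?R" using f by (simp add: homogeneous_part_def)
    then have gC: "g \<in> carrier ?R" by (auto simp: carr g_def keys_filter_terms)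
    have "f - g \<in> ?P"
      using fC by (auto simp: var_ideal_def mono_ideal_def g_def keys_diff_filter_terms carr)
    then have "x = \<pi> g" using \<pi>_eq[OF fC gC] f by simp
    moreover have "keys g \<subseteq> B"
      using f(1) fC by (auto simp: g_def keys_filter_terms B_def homogeneous_part_def carr in_keys_iff)
    ultimately show "x \<in> \<pi> ` {f. keys f \<subseteq> B}" by blast
  next
    fix x assume "x \<in> \<pi> ` {f. keys f \<subseteq> B}"
    moreover have "{f. keys f \<subseteq> B} \<subseteq> (homogeneous_part n d :: 'k mpoly set)"
      unfolding homogeneous_part_def carr B_def by blast
    ultimately show "x \<in> \<pi> ` homogeneous_part n d" by blast
  qed
  moreover have "Q.dimension (card B) (\<pi> ` K0) (\<pi> ` {f. keys f \<subseteq> B})"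
    by (rule dim[OF B(1)]) (auto simp: B_def in_keys_iff)
  ultimately have "Q.dim (\<pi> ` K0) (\<pi> ` homogeneous_part n d) = card B"
    using Q.dimI[OF K] by (simp add: over_def)
  then show ?thesis
    by (simp add: hilbert_function_def Let_def Q_def \<pi>_def K0_def B)
qed

text \<open>The quotient is a polynomial ring in \<open>m = n - card S\<close> variables. For \<open>m = k + 1\<close> its Hilbert polynomial
\<open>(d + 1) \<dots> (d + k) / k!\<close> has degree \<open>k\<close> and leading coefficient \<open>1 / k!\<close>; for \<open>m = 0\<close> the
quotient is the field.\<close>

lemma degree_of_quotient_var_ideal:
  assumes S: "S \<subseteq> {1..n}"
  shows "degree_of_quotient n (var_ideal n S :: 'k::field mpoly set) = 1"
proof -
  let ?P = "var_ideal n S :: 'k mpoly set"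
  define m where "m = n - card S"
  have hf: "hilbert_function n ?P d = (m + d - 1) choose d" for d
    using hilbert_function_var_ideal[OF S, where 'k = 'k] by (simp add: m_def)
  have hp: "hilbert_polynomial n ?P = h"
    if h: "\<forall>\<^sub>F d in sequentially. poly h (of_nat d) = of_nat (hilbert_function n ?P d)" for h :: "rat poly"
    unfolding hilbert_polynomial_def
  proof (rule the_equality[where P = "\<lambda>h. \<forall>\<^sub>F d in sequentially. poly h (of_nat d) = of_nat (hilbert_function n ?P d)"])
    fix h' :: "rat poly" assume "\<forall>\<^sub>F d in sequentially. poly h' (of_nat d) = of_nat (hilbert_function n ?P d)"
    then have "\<forall>\<^sub>F d in sequentially. poly (h' - h) (of_nat d) = 0"
      using h by eventually_elim simp
    then obtain N where N: "\<And>d. d \<ge> N \<Longrightarrow> poly (h' - h) (of_nat d) = 0"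
      by (auto simp: eventually_sequentially)
    have "infinite (of_nat ` {N..} :: rat set)"
      by (subst finite_image_iff) (auto simp: inj_on_def infinite_Ici)
    moreover have "of_nat ` {N..} \<subseteq> {x. poly (h' - h) x = 0}" using N by auto
    ultimately have "h' - h = 0" using poly_roots_finite finite_subset by blast
    then show "h' = h" by simp
  qed (rule h)
  show ?thesis
  proof (cases m)
    case 0
    have "hilbert_polynomial n ?P = 0"
      by (rule hp) (auto simp: hf 0 eventually_sequentially intro!: exI[of _ 1])
    moreover have "{d. hilbert_function n ?P d \<noteq> 0} = {0}"
      by (auto simp: hf 0)
    ultimately show ?thesis by (simp add: degree_of_quotient_def hf)
  next
    case (Suc k)
    define p :: "rat poly" where "p = (\<Prod>i<k. [:of_nat (Suc i), 1:])"
    have p: "Polynomial.degree p = k" "Polynomial.lead_coeff p = 1"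
      unfolding p_def lead_coeff_prod by (simp_all add: degree_prod_eq_sum_degree)
    have "poly (Polynomial.smult (1 / fact k) p) (of_nat d) = of_nat (hilbert_function n ?P d)" for d
    proof -
      have "of_nat ((k + d) choose d) = (of_nat ((k + d) choose k) :: rat)"
        using binomial_symmetric[of d "k + d"] by simp
      also have "\<dots> = pochhammer (of_nat d + 1) k / fact k"
        by (simp add: binomial_gbinomial gbinomial_pochhammer' add.commute)
      also have "pochhammer (of_nat d + 1) k = poly p (of_nat d)"
        unfolding pochhammer_prod p_def poly_prod
        by (intro prod.cong) (auto simp: algebra_simps)
      finally show ?thesis by (simp add: hf Suc)
    qed
    then have hpoly: "hilbert_polynomial n ?P = Polynomial.smult (1 / fact k) p"
      by (intro hp) simp
    have "p \<noteq> 0" using p(2) by auto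
    then show ?thesis using p by (simp add: degree_of_quotient_def Let_def hpoly)
  qed
qed

section \<open>Odd cycles\<close>

lemma relpow_segment:
  assumes "\<And>l. l < k \<Longrightarrow> (f l, f (Suc l)) \<in> A" "i \<le> j" "j \<le> k"
  shows "(f i, f j) \<in> A ^^ (j - i)"
  unfolding relpow_fun_conv
  by (rule exI[of _ "\<lambda>l. f (i + l)"]) (use assms in auto)

lemma relpow_compose: "(x, y) \<in> A ^^ k \<Longrightarrow> (y, z) \<in> A ^^ l \<Longrightarrow> (x, z) \<in> A ^^ (k + l)"
  by (auto simp: relpow_add)

text \<open>A shortest closed walk of odd length runs through an induced cycle: a repeated vertex or a chord would split it into
two shorter closed walks whose lengths add up to an odd number, namely \<open>k\<close> or \<open>k + 2\<close>, so that one of them is odd.\<close>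

lemma shortest_odd_closed_walk:
  assumes sym: "sym A" and irrefl: "\<And>x. (x, x) \<notin> A" and odd: "odd k0" "(x0, x0) \<in> A ^^ k0"
  shows "\<exists>m c. m \<ge> 3 \<and> odd m \<and> inj_on c {..<m} \<and> (\<forall>i<m. (c i, c (Suc i mod m)) \<in> A) \<and>
    (\<forall>i<m. \<forall>j<m. (c i, c j) \<in> A \<longrightarrow> j = Suc i mod m \<or> i = Suc j mod m)"
proof -
  define closed where "closed k \<longleftrightarrow> odd k \<and> (\<exists>x. (x, x) \<in> A ^^ k)" for k
  define k where "k = (LEAST k. closed k)"
  have "closed k0" using odd by (auto simp: closed_def)
  then have "closed k" unfolding k_def by (rule LeastI)
  then have k: "odd k" and "\<exists>x. (x, x) \<in> A ^^ k" by (auto simp: closed_def)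
  have min: "\<not> closed l" if "l < k" for l
    using that not_less_Least unfolding k_def by blast
  obtain f where f: "f 0 = f k" "\<And>i. i < k \<Longrightarrow> (f i, f (Suc i)) \<in> A"
    using \<open>\<exists>x. (x, x) \<in> A ^^ k\<close> unfolding relpow_fun_conv by metis
  have outer: "(f j, f i) \<in> A ^^ (k - j + i)" if "i \<le> j" "j \<le> k" for i j
  proof -
    have "(f j, f k) \<in> A ^^ (k - j)" "(f 0, f i) \<in> A ^^ (i - 0)"
      by (rule relpow_segment[of k]; use f that in auto)+
    then show ?thesis using relpow_compose[of "f j" "f k" "k - j" A "f i" i] f(1) by simp
  qed
  have inner: "(f i, f j) \<in> A ^^ (j - i)" if "i \<le> j" "j \<le> k" for i j
    by (rule relpow_segment[of k]) (use f that in auto)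
  have k1: "k \<noteq> 1" using f irrefl by force
  have k3: "k \<ge> 3"
  proof -
    have "k \<noteq> 0" "k \<noteq> 2" using k by (metis even_zero, metis even_numeral)
    then show ?thesis using k1 by linarith
  qed
  have neq: "f i \<noteq> f j" if "i < j" "j < k" for i j
  proof
    assume eq: "f i = f j"
    have 1: "(f i, f i) \<in> A ^^ (j - i)" "(f i, f i) \<in> A ^^ (k - j + i)"
      using inner[of i j] outer[of i j] eq that by auto
    have "odd (j - i) \<or> odd (k - j + i)"
    proof -
      have "(j - i) + (k - j + i) = k" using that by simp
      then show ?thesis using k by (metis odd_add)
    qed
    moreover have "j - i < k" "k - j + i < k" using that by linarith+
    ultimately show False using 1 min unfolding closed_def by blast
  qed
  have chord: "j = Suc i \<or> (i = 0 \<and> Suc j = k)" if ij: "i < j" "j < k" "(f i, f j) \<in> A" for i j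
  proof (rule ccontr)
    assume neg: "\<not> ?thesis"
    have "(f j, f i) \<in> A" using ij sym by (auto dest: symD)
    then have 1: "(f i, f i) \<in> A ^^ (j - i + 1)" "(f j, f j) \<in> A ^^ (k - j + i + 1)"
      using relpow_compose[OF inner[of i j], of "f i" 1] relpow_compose[OF outer[of i j], of "f j" 1] ij
      by auto
    have "odd (j - i + 1) \<or> odd (k - j + i + 1)"
    proof -
      have "(j - i + 1) + (k - j + i + 1) = k + 2" using ij by simp
      then show ?thesis using k by (metis odd_add even_add even_numeral)
    qed
    moreover have "j - i + 1 < k" "k - j + i + 1 < k" using neg ij by linarith+
    ultimately show False using 1 min unfolding closed_def by blast
  qed
  show ?thesis
  proof (intro exI[of _ k] exI[of _ f] conjI allI impI)
    show "inj_on f {..<k}"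
      unfolding inj_on_def by (metis neq lessThan_iff linorder_neqE_nat)
    show step: "(f i, f (Suc i mod k)) \<in> A" if "i < k" for i
      using f(2)[OF that] f(1) that by (cases "Suc i = k") auto
    show "j = Suc i mod k \<or> i = Suc j mod k" if "i < k" "j < k" "(f i, f j) \<in> A" for i j
    proof -
      have "i \<noteq> j" using that irrefl by auto
      then consider "i < j" | "j < i" by linarith
      then show ?thesis
      proof cases
        case 1
        then show ?thesis using chord[of i j] that by auto
      next
        case 2
        have "(f j, f i) \<in> A" using that sym by (auto dest: symD)
        then show ?thesis using chord[of j i] 2 that by auto
      qed
    qed
  qed (use k3 k in auto)
qed

text \<open>Choose a root in each connected component and colour a vertex by the parity of a walk from the root. Two walks of different
parity to a vertex, or of equal parity to adjacent vertices, would close up to an odd walk.\<close>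

lemma bipartite_if_no_odd_closed_walk:
  assumes sym: "sym A" and no_odd: "\<And>k x. odd k \<Longrightarrow> (x, x) \<notin> A ^^ k"
  shows "\<exists>col :: 'v \<Rightarrow> bool. \<forall>(x, y)\<in>A. col x \<noteq> col y"
proof -
  define root where "root x = (SOME r. (r, x) \<in> A\<^sup>*)" for x
  have root: "(root x, x) \<in> A\<^sup>*" for x unfolding root_def by (rule someI[of _ x]) simp
  have root_eq: "root x = root y" if "(x, y) \<in> A" for x y
  proof -
    have "(y, x) \<in> A" using that sym by (auto dest: symD)
    then have "(r, x) \<in> A\<^sup>* \<longleftrightarrow> (r, y) \<in> A\<^sup>*" for r
      using that by (meson rtrancl.rtrancl_into_rtrancl)
    then show ?thesis by (simp add: root_def)
  qed
  have rev: "(y, x) \<in> A ^^ k" if "(x, y) \<in> A ^^ k" for x y k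
    using that
  proof (induction k arbitrary: y)
    case (Suc k)
    then obtain z where z: "(x, z) \<in> A ^^ k" "(z, y) \<in> A" by auto
    then have "(y, z) \<in> A ^^ 1" using sym by (auto dest: symD)
    then show ?case using relpow_compose[OF _ Suc.IH[OF z(1)]] by fastforce
  qed simp
  define col where "col x \<longleftrightarrow> (\<exists>k. even k \<and> (root x, x) \<in> A ^^ k)" for x
  have "col x \<noteq> col y" if xy: "(x, y) \<in> A" for x y
  proof (cases "col x")
    case True
    then obtain k where k: "even k" "(root x, x) \<in> A ^^ k" by (auto simp: col_def)
    then have 1: "(root y, y) \<in> A ^^ Suc k" using xy root_eq[OF xy] by auto
    have "\<not> col y"
    proof
      assume "col y"
      then obtain l where l: "even l" "(root y, y) \<in> A ^^ l" by (auto simp: col_def)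
      have "(root y, root y) \<in> A ^^ (Suc k + l)" by (rule relpow_compose[OF 1 rev[OF l(2)]])
      then show False using no_odd[of "Suc k + l"] k l by auto
    qed
    then show ?thesis using True by simp
  next
    case False
    obtain k where k: "(root x, x) \<in> A ^^ k" using root rtrancl_imp_relpow by metis
    then have "odd k" using False by (auto simp: col_def)
    moreover have "(root y, y) \<in> A ^^ Suc k" using k xy root_eq[OF xy] by auto
    ultimately have "col y" unfolding col_def by (metis even_Suc)
    then show ?thesis using False by simp
  qed
  then show ?thesis by blast
qed

locale graph =
  fixes V :: "'v set" and E :: "'v set set"
  assumes simple: "simple_graph V E"
begin

lemma edge_card: "e \<in> E \<Longrightarrow> card e = 2" and edge_subset: "e \<in> E \<Longrightarrow> e \<subseteq> V" and finite_V: "finite V"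
  using simple by (auto simp: simple_graph_def)

lemma edge_neq: "{x, y} \<in> E \<Longrightarrow> x \<noteq> y"
  using edge_card[of "{x, y}"] by auto

lemma edgeE:
  assumes "e \<in> E" obtains x y where "e = {x, y}" "x \<noteq> y"
  using edge_card[OF assms] by (auto simp: card_2_iff)

lemma finite_E: "finite E"
  using finite_V edge_subset by (auto intro: finite_subset[of E "Pow V"])

lemma colouring_if_no_odd_induced_cycle:
  assumes X: "X \<subseteq> V" and none: "\<And>S. induced_cycle V E S \<Longrightarrow> odd (card S) \<Longrightarrow> \<not> S \<subseteq> X"
  shows "\<exists>col :: 'v \<Rightarrow> bool. \<forall>x\<in>X. \<forall>y\<in>X. {x, y} \<in> E \<longrightarrow> col x \<noteq> col y"
proof -
  define A where "A = {(x, y). x \<in> X \<and> y \<in> X \<and> {x, y} \<in> E}"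
  have sym: "sym A" by (auto simp: sym_def A_def insert_commute)
  have irrefl: "(x, x) \<notin> A" for x using edge_neq[of x x] by (auto simp: A_def)
  have "(x, x) \<notin> A ^^ k" if "odd k" for k x
  proof
    assume "(x, x) \<in> A ^^ k"
    from shortest_odd_closed_walk[OF sym irrefl that this]
    obtain m c where m: "m \<ge> 3" "odd m" and inj: "inj_on c {..<m}"
      and step: "\<And>i. i < m \<Longrightarrow> (c i, c (Suc i mod m)) \<in> A"
      and chord: "\<And>i j. i < m \<Longrightarrow> j < m \<Longrightarrow> (c i, c j) \<in> A \<Longrightarrow> j = Suc i mod m \<or> i = Suc j mod m"
      by metis
    define S where "S = c ` {..<m}"
    have bij: "bij_betw c {..<m} S" using inj by (simp add: bij_betw_def S_def)
    have SX: "S \<subseteq> X" using step by (auto simp: S_def A_def)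
    have "{e \<in> E. e \<subseteq> S} = {{c i, c (Suc i mod m)} | i. i < m}"
    proof (intro equalityI subsetI)
      fix e assume e: "e \<in> {e \<in> E. e \<subseteq> S}"
      then obtain x y where xy: "e = {x, y}" by (auto elim: edgeE)
      then obtain i j where ij: "x = c i" "y = c j" "i < m" "j < m" using e by (auto simp: S_def)
      then have "(c i, c j) \<in> A" using e xy SX by (auto simp: A_def)
      then show "e \<in> {{c i, c (Suc i mod m)} | i. i < m}"
        using chord[of i j] ij xy by (auto simp: insert_commute)
    next
      fix e assume "e \<in> {{c i, c (Suc i mod m)} | i. i < m}"
      then obtain i where i: "i < m" "e = {c i, c (Suc i mod m)}" by blast
      moreover have "Suc i mod m < m" using i by simp
      ultimately show "e \<in> {e \<in> E. e \<subseteq> S}" using step[of i] by (auto simp: S_def A_def)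
    qed
    then have "induced_cycle V E S"
      unfolding induced_cycle_def using m bij SX X by blast
    moreover have "odd (card S)" using m bij_betw_same_card[OF bij] by simp
    ultimately show False using none SX by blast
  qed
  from bipartite_if_no_odd_closed_walk[OF sym this] show ?thesis
    by (auto simp: A_def)
qed

lemma induced_cycleE:
  assumes "induced_cycle V E S"
  obtains m c where "m \<ge> 3" "bij_betw c {..<m} S" "card S = m"
    "{e \<in> E. e \<subseteq> S} = {{c i, c (Suc i mod m)} | i. i < m}"
  using assms bij_betw_same_card by (fastforce simp: induced_cycle_def)

lemma cycle_card: "induced_cycle V E S \<Longrightarrow> card S \<ge> 3"
  by (auto elim: induced_cycleE)

lemma cycle_subset: "induced_cycle V E S \<Longrightarrow> S \<subseteq> V"
  by (simp add: induced_cycle_def)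

lemma bij_Suc_mod: "m > 0 \<Longrightarrow> bij_betw (\<lambda>i. Suc i mod m) {..<m} {..<m}"
proof -
  assume m: "m > 0"
  have "inj_on (\<lambda>i. Suc i mod m) {..<m}"
  proof (rule inj_onI)
    fix i j assume "i \<in> {..<m}" "j \<in> {..<m}" "Suc i mod m = Suc j mod m"
    then show "i = j" by (cases "Suc i = m"; cases "Suc j = m") auto
  qed
  moreover have "(\<lambda>i. Suc i mod m) ` {..<m} \<subseteq> {..<m}" using m by auto
  ultimately show ?thesis
    by (simp add: bij_betw_def endo_inj_surj)
qed

text \<open>Going once around the cycle, each edge contributes at least \<open>1\<close> and each vertex is counted twice, so
\<open>2 * sum f S\<close> is at least the odd number \<open>card S\<close>, hence larger.\<close>

lemma odd_cycle_cover:
  fixes f :: "'v \<Rightarrow> nat"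
  assumes S: "induced_cycle V E S" "odd (card S)" and cover: "\<And>x y. {x, y} \<in> E \<Longrightarrow> f x + f y \<ge> 1"
  shows "2 * sum f S \<ge> card S + 1"
proof -
  obtain m c where m: "m \<ge> 3" "bij_betw c {..<m} S" "card S = m"
    and E: "{e \<in> E. e \<subseteq> S} = {{c i, c (Suc i mod m)} | i. i < m}"
    using S(1) by (rule induced_cycleE)
  have 1: "sum f S = (\<Sum>i<m. f (c i))" using sum.reindex_bij_betw[OF m(2), of f] by simp
  have 2: "(\<Sum>i<m. f (c (Suc i mod m))) = (\<Sum>i<m. f (c i))"
    using sum.reindex_bij_betw[OF bij_Suc_mod[of m], of "\<lambda>i. f (c i)"] m by simp
  have "{c i, c (Suc i mod m)} \<in> E" if "i < m" for i using E that by blast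
  then have "(\<Sum>i<m. 1) \<le> (\<Sum>i<m. f (c i) + f (c (Suc i mod m)))"
    by (intro sum_mono cover) simp
  then have "m \<le> 2 * sum f S" unfolding sum.distrib 1 2 by simp
  moreover have "m \<noteq> 2 * sum f S" using S(2) m(3) by (metis even_mult_iff even_numeral)
  ultimately show ?thesis using m by linarith
qed

lemma cycle_two_neighbours:
  assumes S: "induced_cycle V E S" and x: "x \<in> S"
  obtains y z where "y \<in> S" "z \<in> S" "y \<noteq> z" "{x, y} \<in> E" "{x, z} \<in> E"
proof -
  obtain m c where m: "m \<ge> 3" "bij_betw c {..<m} S" "card S = m"
    and E: "{e \<in> E. e \<subseteq> S} = {{c i, c (Suc i mod m)} | i. i < m}"
    using S by (rule induced_cycleE)
  obtain i where i: "i < m" "x = c i" using x m(2) by (auto simp: bij_betw_def)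
  \<comment> \<open>The index of the vertex that precedes \<open>c i\<close> on the cycle.\<close>
  define j where "j = (if i = 0 then m - 1 else i - 1)"
  have j: "j < m" "Suc j mod m = i" "Suc i mod m < m" using i m by (auto simp: j_def)
  have neq: "Suc i mod m \<noteq> j" using i m by (cases "Suc i = m") (auto simp: j_def split: if_splits)
  have e: "{c i, c (Suc i mod m)} \<in> E" if "i < m" for i using E that by blast
  have "c (Suc i mod m) \<noteq> c j" using m(2) neq j by (auto simp: bij_betw_def inj_on_def)
  moreover have "{x, c (Suc i mod m)} \<in> E" "{x, c j} \<in> E"
    using e[OF i(1)] e[OF j(1)] i j by (auto simp: insert_commute)
  moreover have "c (Suc i mod m) \<in> S" "c j \<in> S" using m(2) j by (auto simp: bij_betw_def)
  ultimately show ?thesis by (intro that[of "c (Suc i mod m)" "c j"])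
qed

text \<open>A vertex of the inner cycle has two neighbours in it, which must be both of its neighbours in the
outer cycle. So the inner cycle is closed under passing to the next vertex of the outer one.\<close>

lemma cycle_subset_cycle_eq:
  assumes S: "induced_cycle V E S" and T: "induced_cycle V E T" and TS: "T \<subseteq> S"
  shows "T = S"
proof -
  obtain m c where m: "m \<ge> 3" "bij_betw c {..<m} S" "card S = m"
    and E: "{e \<in> E. e \<subseteq> S} = {{c i, c (Suc i mod m)} | i. i < m}"
    using S by (rule induced_cycleE)
  have inj: "c i = c j \<longleftrightarrow> i = j" if "i < m" "j < m" for i j
    using m(2) that by (auto simp: bij_betw_def inj_on_def)
  have next_in: "c (Suc i mod m) \<in> T" if i: "i < m" "c i \<in> T" for i
  proof -
    obtain y z where yz: "y \<in> T" "z \<in> T" "y \<noteq> z" "{c i, y} \<in> E" "{c i, z} \<in> E"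
      using cycle_two_neighbours[OF T i(2)] by metis
    have nb: "\<exists>l<m. w = c l \<and> (l = Suc i mod m \<or> i = Suc l mod m)" if "w \<in> T" "{c i, w} \<in> E" for w
    proof -
      have "{c i, w} \<in> {e \<in> E. e \<subseteq> S}" using that i TS by auto
      then obtain l where l: "l < m" "{c i, w} = {c l, c (Suc l mod m)}" using E by auto
      have l': "Suc l mod m < m" using l by simp
      from l(2) have "(c i = c l \<and> w = c (Suc l mod m)) \<or> (c i = c (Suc l mod m) \<and> w = c l)"
        by (auto simp: doubleton_eq_iff)
      then show ?thesis using inj[OF i(1) l(1)] inj[OF i(1) l'] l(1) l' by blast
    qed
    obtain a b where a: "a < m" "y = c a" "a = Suc i mod m \<or> i = Suc a mod m"
      and b: "b < m" "z = c b" "b = Suc i mod m \<or> i = Suc b mod m"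
      using nb[OF yz(1,4)] nb[OF yz(2,5)] by blast
    have "a \<noteq> b" using a b yz(3) by auto
    moreover have "a = b" if "i = Suc a mod m" "i = Suc b mod m"
      using inj_onD[OF bij_betw_imp_inj_on[OF bij_Suc_mod], of m a b] a(1) b(1) that by simp
    ultimately have "a = Suc i mod m \<or> b = Suc i mod m" using a(3) b(3) by blast
    then show ?thesis using a(2) b(2) yz(1,2) by blast
  qed
  have "T \<noteq> {}" using cycle_card[OF T] by auto
  then obtain i0 where i0: "i0 < m" "c i0 \<in> T" using TS m(2) by (force simp: bij_betw_def)
  have "c ((i0 + k) mod m) \<in> T" for k
  proof (induction k)
    case (Suc k)
    have "(i0 + k) mod m < m" using m by simp
    from next_in[OF this Suc] show ?case by (simp add: mod_Suc_eq)
  qed (use i0 in simp)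
  note all = this
  have "c j \<in> T" if "j < m" for j
  proof -
    have "(i0 + (m - i0 + j)) mod m = j" using that i0 by simp
    then show ?thesis using all[of "m - i0 + j"] by simp
  qed
  then have "S \<subseteq> T" using m(2) by (auto simp: bij_betw_def)
  then show ?thesis using TS by blast
qed

end

section \<open>The square of the cover ideal\<close>

definition incidence :: "nat set \<Rightarrow> (nat \<Rightarrow>\<^sub>0 nat)" where
  "incidence S = (\<Sum>j\<in>S. Poly_Mapping.single j 1)"

lemma lookup_incidence: "finite S \<Longrightarrow> lookup (incidence S) i = (if i \<in> S then 1 else 0)"
  unfolding incidence_def by (rule lookup_sum_single)

lemma keys_incidence: "finite S \<Longrightarrow> keys (incidence S) = S"
  by (auto simp: in_keys_iff lookup_incidence split: if_splits)

text \<open>The exponent vectors of the component with support \<open>S\<close>: for an edge this is the square of the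
prime \<open>(x\<^sub>i | i \<in> S)\<close>, for an odd cycle it is the irreducible ideal generated by the squares \<open>x\<^sub>i\<^sup>2\<close>. The cardinality
tells the two cases apart.\<close>

definition component_cond :: "nat set \<Rightarrow> (nat \<Rightarrow>\<^sub>0 nat) \<Rightarrow> bool" where
  "component_cond S u \<longleftrightarrow>
     (if card S = 2 then (\<Sum>i\<in>S. lookup u i) \<ge> 2 else \<exists>i\<in>S. lookup u i \<ge> 2)"

lemma component_cond_edge: "i \<noteq> j \<Longrightarrow> component_cond {i, j} u \<longleftrightarrow> lookup u i + lookup u j \<ge> 2"
  by (simp add: component_cond_def)

lemma component_cond_not_edge: "card S \<noteq> 2 \<Longrightarrow> component_cond S u \<longleftrightarrow> (\<exists>i\<in>S. lookup u i \<ge> 2)"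
  by (simp add: component_cond_def)

lemma upclosed_component_cond: "upclosed (component_cond S)"
  by (auto simp: upclosed_def component_cond_def lookup_add sum.distrib intro: trans_le_add1)

lemma depends_on_component_cond:
  assumes "S \<subseteq> T"
  shows "depends_on T (component_cond S)"
  unfolding depends_on_def
proof (intro allI impI)
  fix u v :: "nat \<Rightarrow>\<^sub>0 nat" assume "\<forall>i\<in>T. lookup u i = lookup v i"
  then have eq: "lookup u i = lookup v i" if "i \<in> S" for i using assms that by blast
  then show "component_cond S u = component_cond S v"
    by (simp add: component_cond_def cong: sum.cong)
qed

lemma component_cond_square:
  assumes "finite S" "i \<in> S" "lookup u i \<ge> 2"
  shows "component_cond S u"
proof -
  have "lookup u i \<le> (\<Sum>i\<in>S. lookup u i)" using assms by (intro member_le_sum) auto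
  then show ?thesis using assms by (auto simp: component_cond_def)
qed

locale nat_graph = graph "{1..n}" E for n :: nat and E :: "nat set set"
begin

definition odd_cycles :: "nat set set" where
  "odd_cycles = {S. induced_cycle {1..n} E S \<and> odd (card S)}"

definition J :: "'k::field mpoly set" where "J = alexander_dual n (edge_ideal n E)"

definition covers :: "(nat \<Rightarrow>\<^sub>0 nat) \<Rightarrow> bool" where
  "covers u \<longleftrightarrow> (\<forall>e\<in>E. \<exists>i\<in>e. lookup u i \<noteq> 0)"

lemma odd_cycle_card: "S \<in> odd_cycles \<Longrightarrow> card S \<noteq> 2" "S \<in> odd_cycles \<Longrightarrow> card S \<ge> 3"
  using cycle_card[of S] by (auto simp: odd_cycles_def)

lemma odd_cycle_subset: "S \<in> odd_cycles \<Longrightarrow> S \<subseteq> {1..n}"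
  using cycle_subset[of S] by (simp add: odd_cycles_def)

lemma finite_edge: "e \<in> E \<Longrightarrow> finite e"
  using edge_subset finite_subset by blast

lemma edge_ideal_eq:
  "edge_ideal n E = (mono_ideal n (\<lambda>u. \<exists>e\<in>E. \<exists>v. u = incidence e + v) :: 'k::field mpoly set)"
proof -
  have "{var i * var j | i j. {i, j} \<in> E} = (monomial ` (incidence ` E) :: 'k mpoly set)"
  proof (intro equalityI subsetI)
    fix f :: "'k mpoly" assume "f \<in> {var i * var j | i j. {i, j} \<in> E}"
    then obtain i j where ij: "{i, j} \<in> E" "f = var i * var j" by blast
    then have "f = monomial (incidence {i, j})"
      using edge_neq[OF ij(1)] by (simp add: var_def monomial_def mult_single incidence_def)
    then show "f \<in> monomial ` incidence ` E" using ij by blast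
  next
    fix f :: "'k mpoly" assume "f \<in> monomial ` (incidence ` E)"
    then obtain e where e: "e \<in> E" "f = monomial (incidence e)" by blast
    then obtain i j where ij: "e = {i, j}" "i \<noteq> j" by (auto elim: edgeE)
    then have "f = var i * var j"
      using e by (simp add: var_def monomial_def mult_single incidence_def)
    then show "f \<in> {var i * var j | i j. {i, j} \<in> E}" using e ij by blast
  qed
  then have "edge_ideal n E = Idl\<^bsub>poly_ring n\<^esub> (monomial ` (incidence ` E) :: 'k mpoly set)"
    by (simp add: edge_ideal_def)
  also have "\<dots> = mono_ideal n (\<lambda>u. \<exists>g\<in>incidence ` E. \<exists>v. u = g + v)"
  proof (rule Idl_monomials)
    show "keys g \<subseteq> {1..n}" if "g \<in> incidence ` E" for g
      using that keys_incidence[OF finite_edge] edge_subset by auto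
  qed
  finally show ?thesis by simp
qed

text \<open>No edge contains another one, so no generator of the edge ideal is redundant.\<close>

lemma minimal_generators_edge_ideal:
  "minimal_generators (edge_ideal n E :: 'k::field mpoly set) = incidence ` E"
proof (intro equalityI subsetI)
  have mem: "(monomial u :: 'k mpoly) \<in> edge_ideal n E \<longleftrightarrow>
      keys u \<subseteq> {1..n} \<and> (\<exists>e\<in>E. \<exists>v. u = incidence e + v)" for u
    unfolding edge_ideal_eq by simp
  have inc: "(monomial (incidence e) :: 'k mpoly) \<in> edge_ideal n E" if "e \<in> E" for e
    unfolding mem using that edge_subset keys_incidence finite_edge
    by (auto intro!: bexI[of _ e] exI[of _ 0])
  {
    fix u assume u: "u \<in> minimal_generators (edge_ideal n E :: 'k mpoly set)"
    then obtain e v where e: "e \<in> E" "u = incidence e + v"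
      by (auto simp: minimal_generators_def mem)
    then have "incidence e = u" using u inc[OF e(1)] by (auto simp: minimal_generators_def)
    then show "u \<in> incidence ` E" using e by blast
  next
    fix u assume "u \<in> incidence ` E"
    then obtain e where e: "e \<in> E" "u = incidence e" by blast
    have "v = u" if v: "(monomial v :: 'k mpoly) \<in> edge_ideal n E" "u = v + w" for v w
    proof -
      obtain e' v' where e': "e' \<in> E" "v = incidence e' + v'" using v by (auto simp: mem)
      have eq: "incidence e = incidence e' + (v' + w)" using e v e' by (simp add: add.assoc)
      have "e' \<subseteq> e"
        using arg_cong[OF eq, of keys] e e' finite_edge by (auto simp: keys_add_nat keys_incidence)
      then have "e' = e" using edge_card e e' finite_edge by (metis card_subset_eq)
      then have "v' + w = 0" using eq by simp
      then have "keys v' \<union> keys w = {}" by (metis keys_add_nat keys_zero)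
      then have "w = 0" by simp
      then show ?thesis using v by simp
    qed
    then show "u \<in> minimal_generators (edge_ideal n E :: 'k mpoly set)"
      using inc e by (auto simp: minimal_generators_def)
  }
qed

lemma J_eq: "J = (mono_ideal n covers :: 'k::field mpoly set)"
proof -
  have "(\<Inter>u\<in>incidence ` E. Idl\<^bsub>poly_ring n\<^esub> (var ` keys u)) = (\<Inter>e\<in>E. var_ideal n e :: 'k mpoly set)"
    using edge_subset finite_edge by (simp add: keys_incidence Idl_vars)
  then have "J = (mono_ideal n (\<lambda>_. True) \<inter> (\<Inter>e\<in>E. var_ideal n e) :: 'k mpoly set)"
    unfolding J_def alexander_dual_def minimal_generators_edge_ideal carrier_poly_ring by simp
  also have "\<dots> = mono_ideal n covers"
    by (auto simp: mono_ideal_def var_ideal_def covers_def)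
  finally show ?thesis .
qed

lemma upclosed_covers: "upclosed covers"
  by (auto simp: upclosed_def covers_def lookup_add)

text \<open>The primary decomposition of the square of the cover ideal, on exponent vectors. A sum of two covers has total at least
\<open>card S + 1\<close> on an odd cycle \<open>S\<close>, so some entry there is at least \<open>2\<close>. Conversely, give an entry of at
least \<open>2\<close> to both covers and distribute the entries equal to \<open>1\<close> according to a proper 2-colouring of
the vertices that carry them; it exists because these vertices contain no odd induced cycle.\<close>

lemma two_covers_iff:
  "(\<exists>v w. covers v \<and> covers w \<and> u = v + w) \<longleftrightarrow> (\<forall>S\<in>E \<union> odd_cycles. component_cond S u)"
proof
  assume "\<exists>v w. covers v \<and> covers w \<and> u = v + w"
  then obtain v w where vw: "covers v" "covers w" "u = v + w" by blast
  have edge: "lookup v i + lookup v j \<ge> 1" "lookup w i + lookup w j \<ge> 1" if "{i, j} \<in> E" for i j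
    using vw(1,2) that by (force simp: covers_def)+
  show "\<forall>S\<in>E \<union> odd_cycles. component_cond S u"
  proof
    fix S assume "S \<in> E \<union> odd_cycles"
    then show "component_cond S u"
    proof
      assume "S \<in> E"
      then obtain i j where "S = {i, j}" "i \<noteq> j" by (rule edgeE)
      then show ?thesis using edge[of i j] \<open>S \<in> E\<close> by (simp add: component_cond_edge vw lookup_add)
    next
      assume S: "S \<in> odd_cycles"
      show ?thesis
      proof (rule ccontr)
        assume "\<not> component_cond S u"
        then have "lookup u i \<le> 1" if "i \<in> S" for i
          using that odd_cycle_card(1)[OF S] by (force simp: component_cond_not_edge)
        then have "(\<Sum>i\<in>S. lookup u i) \<le> (\<Sum>i\<in>S. 1)" by (rule sum_mono)
        then have "2 * sum (lookup v) S + 2 * sum (lookup w) S \<le> 2 * card S"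
          by (simp add: vw lookup_add sum.distrib)
        moreover have "2 * sum (lookup v) S \<ge> card S + 1" "2 * sum (lookup w) S \<ge> card S + 1"
          using odd_cycle_cover[of S "lookup v"] odd_cycle_cover[of S "lookup w"] edge S
          unfolding odd_cycles_def by blast+
        ultimately show False by linarith
      qed
    qed
  qed
next
  assume cond: "\<forall>S\<in>E \<union> odd_cycles. component_cond S u"
  define X where "X = {i \<in> {1..n}. lookup u i = 1}"
  have "\<exists>col :: nat \<Rightarrow> bool. \<forall>x\<in>X. \<forall>y\<in>X. {x, y} \<in> E \<longrightarrow> col x \<noteq> col y"
  proof (rule colouring_if_no_odd_induced_cycle)
    show "X \<subseteq> {1..n}" by (auto simp: X_def)
    show "\<not> S \<subseteq> X" if "induced_cycle {1..n} E S" "odd (card S)" for S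
    proof
      assume "S \<subseteq> X"
      have S: "S \<in> odd_cycles" using that by (simp add: odd_cycles_def)
      then have "component_cond S u" using cond by blast
      then obtain i where "i \<in> S" "lookup u i \<ge> 2"
        using odd_cycle_card(1)[OF S] by (auto simp: component_cond_not_edge)
      then show False using \<open>S \<subseteq> X\<close> by (auto simp: X_def)
    qed
  qed
  then obtain col :: "nat \<Rightarrow> bool" where col: "\<forall>x\<in>X. \<forall>y\<in>X. {x, y} \<in> E \<longrightarrow> col x \<noteq> col y" ..
  define v where "v = incidence {i \<in> {1..n}. lookup u i \<ge> 2 \<or> (lookup u i = 1 \<and> col i)}"
  have v: "lookup v i = (if i \<in> {1..n} \<and> (lookup u i \<ge> 2 \<or> (lookup u i = 1 \<and> col i)) then 1 else 0)" for i
    by (simp add: v_def lookup_incidence)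
  have w: "lookup (u - v) i = lookup u i - lookup v i" for i by (simp add: lookup_minus)
  have both: "(lookup v i \<noteq> 0 \<or> lookup v j \<noteq> 0) \<and> (lookup (u - v) i \<noteq> 0 \<or> lookup (u - v) j \<noteq> 0)"
    if ij: "{i, j} \<in> E" for i j
  proof -
    have n: "i \<in> {1..n}" "j \<in> {1..n}" using edge_subset[OF ij] by auto
    have "lookup u i + lookup u j \<ge> 2" using cond ij edge_neq[OF ij] component_cond_edge by blast
    then consider "lookup u i \<ge> 2" | "lookup u j \<ge> 2" | "lookup u i = 1" "lookup u j = 1" by linarith
    then show ?thesis
    proof cases
      case 3
      then have "col i \<noteq> col j" using col n ij by (simp add: X_def)
      then show ?thesis using 3 n unfolding v w by auto
    qed (use n in \<open>auto simp: v w\<close>)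
  qed
  have "covers v" "covers (u - v)"
  proof -
    show "covers v"
      unfolding covers_def using both by (metis edgeE insertCI)
    show "covers (u - v)"
      unfolding covers_def using both by (metis edgeE insertCI)
  qed
  moreover have "u = v + (u - v)"
    by (rule poly_mapping_eqI) (auto simp: lookup_add lookup_minus v)
  ultimately show "\<exists>v w. covers v \<and> covers w \<and> u = v + w" by blast
qed

sublocale square_components n "E \<union> odd_cycles" component_cond
proof
  fix S assume S: "S \<in> E \<union> odd_cycles"
  show "S \<subseteq> {1..n}" using S edge_subset odd_cycle_subset by blast
  then have "finite S" using finite_subset by blast
  then show "component_cond S u" if "i \<in> S" "lookup u i \<ge> 2" for u i
    using component_cond_square that by blast
qed (auto intro: upclosed_component_cond depends_on_component_cond)

lemma J_squared: "J \<cdot>\<^bsub>poly_ring n\<^esub> J = (Q :: 'k::field mpoly set)"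
  unfolding J_eq ideal_prod_mono_ideal[OF upclosed_covers upclosed_covers] two_covers_iff Q_def
  by (rule refl)

section \<open>The arithmetic degree\<close>

text \<open>Locally at an edge \<open>{i, j}\<close> the ideal is the square of the maximal ideal \<open>(x\<^sub>i, x\<^sub>j)\<close>, and the quotient
has the basis \<open>x\<^sub>i, x\<^sub>j, 1\<close>, listed in the order of the filtration.\<close>

lemma mult_at_edge:
  assumes e: "e \<in> E"
  shows "mult_at n (Q :: 'k::field mpoly set) (var_ideal n e) = 3"
proof -
  obtain i j where ij: "e = {i, j}" "i \<noteq> j" using e by (rule edgeE)
  define V where "V l u \<longleftrightarrow> (if l = 0 then lookup u i + lookup u j \<ge> 2
      else if l = 1 then lookup u i \<ge> 1 \<or> lookup u j \<ge> 2
      else if l = 2 then lookup u i \<ge> 1 \<or> lookup u j \<ge> 1 else True)"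
    for l :: nat and u :: "nat \<Rightarrow>\<^sub>0 nat"
  define g :: "nat \<Rightarrow> (nat \<Rightarrow>\<^sub>0 nat)" where
    "g l = (if l = 0 then Poly_Mapping.single i 1 else if l = 1 then Poly_Mapping.single j 1 else 0)" for l
  have l3: "l = 0 \<or> l = 1 \<or> l = 2" if "l < 3" for l :: nat using that by linarith
  show ?thesis
  proof (rule mult_at_component[where V = V and g = g])
    show "e \<subseteq> {1..n}" by (rule edge_subset[OF e])
    show "V 0 u \<longleftrightarrow> (\<forall>S\<in>E \<union> odd_cycles. S \<subseteq> e \<longrightarrow> component_cond S u)" for u
    proof -
      have "S = e" if S: "S \<in> E \<union> odd_cycles" "S \<subseteq> e" for S
      proof -
        have "card S \<ge> 2" using S(1) edge_card odd_cycle_card(2) by fastforce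
        then show ?thesis
          using S(2) edge_card[OF e] finite_edge[OF e] by (intro card_seteq) auto
      qed
      then have "(\<forall>S\<in>E \<union> odd_cycles. S \<subseteq> e \<longrightarrow> component_cond S u) \<longleftrightarrow> component_cond e u"
        using e by blast
      then show ?thesis using ij by (simp add: V_def component_cond_edge)
    qed
    show "upclosed (V l)" for l by (auto simp: upclosed_def V_def lookup_add)
    show "depends_on e (V l)" for l by (auto simp: depends_on_def V_def ij)
    show "keys (g l) \<subseteq> {1..n}" for l using edge_subset[OF e] by (auto simp: g_def ij)
    show "V (Suc l) (g l)" "\<not> V l (g l)" if "l < 3" for l
      using l3[OF that] ij(2) by (auto simp: V_def g_def lookup_single when_def)
    show "V (Suc l) u" if "l < 3" "V l u" for l u
      using l3[OF that(1)] that(2) by (auto simp: V_def)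
    show "V l u \<or> (\<exists>v. u = g l + v)" if "l < 3" "V (Suc l) u" for l u
      unfolding le_iff_ex_add using l3[OF that(1)] that(2) ij(2)
      by (auto simp: V_def g_def lookup_single when_def)
    show "V l (g l + Poly_Mapping.single k 1)" if "l < 3" "k \<in> e" for l k
      using l3[OF that(1)] that(2) ij by (auto simp: V_def g_def lookup_add lookup_single when_def)
    show "V 3 u" for u by (simp add: V_def)
  qed
qed

lemma odd_cycle_subset_odd_cycle_eq:
  "S \<in> odd_cycles \<Longrightarrow> T \<in> odd_cycles \<Longrightarrow> T \<subseteq> S \<Longrightarrow> T = S"
  using cycle_subset_cycle_eq by (auto simp: odd_cycles_def)

text \<open>Locally at an odd cycle \<open>C\<close> only the components of \<open>C\<close> and of its edges survive. A monomial that
satisfies the edge conditions but not the condition of \<open>C\<close> has all exponents on \<open>C\<close> equal to \<open>1\<close>; so the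
largest ideal of finite length is spanned by the class of the product of the variables in \<open>C\<close>, which every variable
of \<open>C\<close> kills.\<close>

lemma mult_at_odd_cycle:
  assumes C: "C \<in> odd_cycles"
  shows "mult_at n (Q :: 'k::field mpoly set) (var_ideal n C) = 1"
proof -
  have sub: "C \<subseteq> {1..n}" by (rule odd_cycle_subset[OF C])
  then have fin: "finite C" using finite_subset by blast
  define V where "V l u \<longleftrightarrow> (\<forall>S\<in>E. S \<subseteq> C \<longrightarrow> component_cond S u) \<and> (l = 0 \<longrightarrow> component_cond C u)"
    for l :: nat and u :: "nat \<Rightarrow>\<^sub>0 nat"
  have condC: "component_cond C u \<longleftrightarrow> (\<exists>i\<in>C. lookup u i \<ge> 2)" for u
    by (rule component_cond_not_edge[OF odd_cycle_card(1)[OF C]])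
  have edges: "component_cond S (incidence C)" if "S \<in> E" "S \<subseteq> C" for S
  proof -
    obtain x y where "S = {x, y}" "x \<noteq> y" using \<open>S \<in> E\<close> by (rule edgeE)
    then show ?thesis using that fin by (simp add: component_cond_edge lookup_incidence)
  qed
  show ?thesis
  proof (rule mult_at_component[where V = V and g = "\<lambda>_. incidence C"])
    show "C \<subseteq> {1..n}" by (rule sub)
    show "V 0 u \<longleftrightarrow> (\<forall>S\<in>E \<union> odd_cycles. S \<subseteq> C \<longrightarrow> component_cond S u)" for u
      unfolding V_def using odd_cycle_subset_odd_cycle_eq[OF C] C by blast
    show "upclosed (V l)" for l
      unfolding upclosed_def V_def using upclosedD[OF upclosed_component_cond] by blast
    show "depends_on C (V l)" for l
      unfolding depends_on_def V_def
      using depends_onD[OF depends_on_component_cond[where T = C]] by (metis order_refl)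
    show "keys (incidence C) \<subseteq> {1..n}" using sub fin by (simp add: keys_incidence)
    show "V (Suc l) (incidence C)" for l using edges by (simp add: V_def)
    show "\<not> V l (incidence C)" if "l < 1" for l
      using that fin by (simp add: V_def condC lookup_incidence)
    show "V (Suc l) u" if "V l u" for l u using that by (simp add: V_def)
    show "V l u \<or> (\<exists>v. u = incidence C + v)" if "V (Suc l) u" for l u
    proof (cases "\<exists>i\<in>C. lookup u i \<ge> 2")
      case True
      then show ?thesis using that by (simp add: V_def condC)
    next
      case False
      have "lookup u x \<ge> 1" if x: "x \<in> C" for x
      proof -
        obtain y where y: "y \<in> C" "{x, y} \<in> E"
          using cycle_two_neighbours[of C x] C x by (metis odd_cycles_def mem_Collect_eq)
        then have "component_cond {x, y} u" using \<open>V (Suc l) u\<close> x by (auto simp: V_def)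
        then have "lookup u x + lookup u y \<ge> 2" using edge_neq[OF y(2)] by (simp add: component_cond_edge)
        moreover have "lookup u y < 2" using False y by auto
        ultimately show ?thesis by linarith
      qed
      then show ?thesis unfolding le_iff_ex_add using fin by (simp add: lookup_incidence)
    qed
    show "V l (incidence C + Poly_Mapping.single i 1)" if "i \<in> C" for l i
    proof -
      have "lookup (incidence C + Poly_Mapping.single i 1) i \<ge> 2"
        using that fin by (simp add: lookup_add lookup_incidence)
      then show ?thesis
        unfolding V_def condC using edges upclosedD[OF upclosed_component_cond] that by blast
    qed
    show "V 1 u" if "\<And>S. S \<in> E \<union> odd_cycles \<Longrightarrow> S \<subset> C \<Longrightarrow> component_cond S u" for u
      unfolding V_def
    proof (intro conjI ballI impI)
      fix S assume "S \<in> E" "S \<subseteq> C"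
      moreover have "S \<noteq> C" using edge_card[OF \<open>S \<in> E\<close>] odd_cycle_card(1)[OF C] by auto
      ultimately show "component_cond S u" using that by blast
    qed simp
  qed
qed

lemma finite_odd_cycles: "finite odd_cycles"
  using odd_cycle_subset by (intro finite_subset[of odd_cycles "Pow {1..n}"]) auto

text \<open>Every edge contributes \<open>3\<close> and every odd induced cycle \<open>1\<close>; all other primes contribute nothing.\<close>

theorem adeg_J_squared: "adeg n (J \<cdot>\<^bsub>poly_ring n\<^esub> J :: 'k::field mpoly set) = of_nat (3 * card E + card odd_cycles)"
proof -
  have mult: "mult_at n (Q :: 'k mpoly set) (var_ideal n S) = (if S \<in> E then 3 else 1)"
    if "S \<in> E \<union> odd_cycles" for S
    using that mult_at_edge mult_at_odd_cycle by auto
  have index: "{P. primeideal P (poly_ring n) \<and> homogeneous_ideal n P \<and> mult_at n (Q :: 'k mpoly set) P \<noteq> 0} =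
      var_ideal n ` (E \<union> odd_cycles)"
    (is "?I = _")
  proof (intro equalityI subsetI)
    fix P assume "P \<in> ?I"
    then show "P \<in> var_ideal n ` (E \<union> odd_cycles)"
      using mult_at_other_prime[of P] unfolding image_iff by auto
  next
    fix P :: "'k mpoly set" assume "P \<in> var_ideal n ` (E \<union> odd_cycles)"
    then obtain S where S: "S \<in> E \<union> odd_cycles" "P = var_ideal n S" by blast
    then show "P \<in> ?I"
      using mult[OF S(1)]
      by (auto intro!: primeideal_var_ideal[OF finite_S[OF S(1)]] homogeneous_var_ideal[OF F[OF S(1)]]
          simp del: Un_iff)
  qed
  have inj: "inj_on (var_ideal n :: nat set \<Rightarrow> 'k mpoly set) (E \<union> odd_cycles)"
    using var_ideal_eq_iff F by (intro inj_onI) blast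
  have disj: "E \<inter> odd_cycles = {}" using edge_card odd_cycle_card(1) by blast
  have "adeg n (Q :: 'k mpoly set) = (\<Sum>S\<in>E \<union> odd_cycles. of_nat (if S \<in> E then 3 else 1))"
    unfolding adeg_def index sum.reindex[OF inj] comp_def
    using F by (intro sum.cong refl) (simp add: mult degree_of_quotient_var_ideal)
  also have "\<dots> = (\<Sum>S\<in>E. 3) + (\<Sum>S\<in>odd_cycles. 1)"
    unfolding sum.union_disjoint[OF finite_E finite_odd_cycles disj]
    using disj by (intro arg_cong2[of _ _ _ _ "(+)"] sum.cong refl) auto
  finally show ?thesis by (simp add: J_squared)
qed

lemma card_odd_cycles:
  "card odd_cycles = num_triangles {1..n} E + card {S. odd_hole {1..n} E S}"
proof -
  have "odd_cycles = {S. induced_cycle {1..n} E S \<and> card S = 3} \<union> {S. odd_hole {1..n} E S}"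
  proof (intro equalityI subsetI)
    fix S assume S: "S \<in> odd_cycles"
    have "card S = 3 \<or> card S \<ge> 5"
    proof -
      have "odd (card S)" using S by (simp add: odd_cycles_def)
      then have "card S \<noteq> 4" by auto
      then show ?thesis using odd_cycle_card(2)[OF S] by linarith
    qed
    then show "S \<in> {S. induced_cycle {1..n} E S \<and> card S = 3} \<union> {S. odd_hole {1..n} E S}"
      using S by (auto simp: odd_cycles_def odd_hole_def)
  qed (auto simp: odd_cycles_def odd_hole_def)
  moreover have "finite {S. induced_cycle {1..n} E S \<and> card S = 3}" "finite {S. odd_hole {1..n} E S}"
    by (rule finite_subset[OF _ finite_odd_cycles]; auto simp: odd_cycles_def odd_hole_def)+
  moreover have "{S. induced_cycle {1..n} E S \<and> card S = 3} \<inter> {S. odd_hole {1..n} E S} = {}"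
    by (auto simp: odd_hole_def)
  ultimately show ?thesis unfolding num_triangles_def by (simp add: card_Un_disjoint)
qed

lemma finite_odd_holes: "finite {S. odd_hole {1..n} E S}"
  by (rule finite_subset[OF _ finite_odd_cycles]) (auto simp: odd_cycles_def odd_hole_def)

theorem adeg_iff_no_odd_hole:
  "adeg n (J \<cdot>\<^bsub>poly_ring n\<^esub> J :: 'k::field mpoly set) = of_nat (3 * card E + num_triangles {1..n} E) \<longleftrightarrow>
    (\<nexists>S. odd_hole {1..n} E S)"
  unfolding adeg_J_squared card_odd_cycles of_nat_eq_iff using finite_odd_holes by auto

section \<open>The colon ideal\<close>

definition quadruples :: "(nat \<times> nat \<times> nat \<times> nat) set" where
  "quadruples = {(i\<^sub>1, i\<^sub>2, i\<^sub>3, i\<^sub>4). 1 \<le> i\<^sub>1 \<and> i\<^sub>1 < i\<^sub>2 \<and> i\<^sub>2 < i\<^sub>3 \<and> i\<^sub>3 < i\<^sub>4 \<and> i\<^sub>4 \<le> n}"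

definition quad_sum :: "nat \<times> nat \<times> nat \<times> nat \<Rightarrow> 'k::field mpoly" where
  "quad_sum = (\<lambda>(i\<^sub>1, i\<^sub>2, i\<^sub>3, i\<^sub>4). var i\<^sub>1 + var i\<^sub>2 + var i\<^sub>3 + var i\<^sub>4)"

lemma finite_quadruples: "finite quadruples"
  by (rule finite_subset[of _ "{1..n} \<times> {1..n} \<times> {1..n} \<times> {1..n}"]) (auto simp: quadruples_def)

lemma single_one_eq_iff [simp]:
  "Poly_Mapping.single i (Suc 0) = Poly_Mapping.single j (Suc 0) \<longleftrightarrow> i = j"
  by (metis keys_single nat.simps(3) singleton_inject)

text \<open>The four variables are distinct, so none of them cancels, whatever the characteristic of the field.\<close>

lemma quad_sum_in_var_ideal_iff:
  assumes "(a, b, c, d) \<in> quadruples"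
  shows "(quad_sum (a, b, c, d) :: 'k::field mpoly) \<in> var_ideal n S \<longleftrightarrow> {a, b, c, d} \<subseteq> S"
proof
  assume in_P: "(quad_sum (a, b, c, d) :: 'k mpoly) \<in> var_ideal n S"
  show "{a, b, c, d} \<subseteq> S"
  proof
    fix i assume i: "i \<in> {a, b, c, d}"
    have "lookup (quad_sum (a, b, c, d) :: 'k mpoly) (Poly_Mapping.single i 1) = 1"
      using i assms
      by (auto simp: quad_sum_def quadruples_def var_def monomial_def lookup_add lookup_single when_def)
    then have "Poly_Mapping.single i 1 \<in> keys (quad_sum (a, b, c, d) :: 'k mpoly)"
      by (simp add: in_keys_iff)
    then obtain j where "j \<in> S" "lookup (Poly_Mapping.single i (1 :: nat)) j \<noteq> 0"
      using in_P by (auto simp: var_ideal_def mono_ideal_def)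
    then show "i \<in> S" by (simp add: lookup_single when_def split: if_splits)
  qed
next
  assume "{a, b, c, d} \<subseteq> S"
  then have "var a \<in> (var_ideal n S :: 'k mpoly set)" "var b \<in> (var_ideal n S :: 'k mpoly set)"
    "var c \<in> (var_ideal n S :: 'k mpoly set)" "var d \<in> (var_ideal n S :: 'k mpoly set)"
    using assms by (auto simp: quadruples_def)
  then show "(quad_sum (a, b, c, d) :: 'k mpoly) \<in> var_ideal n S"
    by (auto simp: quad_sum_def var_ideal_def intro!: mono_ideal_add)
qed

lemma prod_in_var_ideal_iff:
  fixes h :: "'x \<Rightarrow> 'k::field mpoly"
  assumes S: "finite S" and X: "finite X" and h: "\<And>x. x \<in> X \<Longrightarrow> h x \<in> carrier (poly_ring n)"
  shows "prod h X \<in> carrier (poly_ring n) \<and> (prod h X \<in> var_ideal n S \<longleftrightarrow> (\<exists>x\<in>X. h x \<in> var_ideal n S))"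
  using X h
proof (induction X rule: finite_induct)
  case empty
  then show ?case by (simp add: carrier_poly_ring var_ideal_def)
next
  case (insert x X)
  interpret P: primeideal "var_ideal n S :: 'k mpoly set" "poly_ring n" by (rule primeideal_var_ideal[OF S])
  have hx: "h x \<in> carrier (poly_ring n)" "prod h X \<in> carrier (poly_ring n)" using insert by auto
  have "h x * prod h X \<in> var_ideal n S \<longleftrightarrow> h x \<in> var_ideal n S \<or> prod h X \<in> var_ideal n S"
    using P.I_prime[OF hx] P.I_l_closed[OF _ hx(1)] P.I_r_closed[OF _ hx(2)] by auto
  moreover have "h x * prod h X \<in> carrier (poly_ring n)" using P.m_closed[OF hx] by simp
  ultimately show ?case using insert by simp
qed

definition L :: "'k::field mpoly" where "L = prod quad_sum quadruples"

lemma quad_sum_carrier: "x \<in> quadruples \<Longrightarrow> quad_sum x \<in> carrier (poly_ring n)"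
  by (auto simp: quad_sum_def quadruples_def carrier_poly_ring var_in_mono_ideal intro!: mono_ideal_add)

lemma L_carrier: "L \<in> carrier (poly_ring n)"
  unfolding L_def
  using prod_in_var_ideal_iff[OF finite.emptyI finite_quadruples, of quad_sum] quad_sum_carrier by blast

lemma four_increasing:
  assumes "finite (S :: nat set)" "card S \<ge> 4"
  obtains a b c d where "{a, b, c, d} \<subseteq> S" "a < b" "b < c" "c < d"
proof -
  obtain T where T: "T \<subseteq> S" "card T = 4" using obtain_subset_with_card_n[OF assms(2)] by blast
  have finT: "finite T" using T(2) card.infinite by fastforce
  obtain xs where xs: "sorted_wrt (<) xs" "set xs = T" "length xs = card T"
    using sorted_list_of_set.finite_set_strict_sorted[OF finT] by blast
  then obtain a b c d where "xs = [a, b, c, d]"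
    using T(2) by (auto simp: length_Suc_conv eval_nat_numeral)
  moreover note xs(1,2)
  ultimately show ?thesis using that[of a b c d] T by auto
qed

text \<open>This is what \<open>L\<close> is made for: it lies in the prime of an odd cycle exactly when the cycle is not a triangle, and never
in the prime of an edge.\<close>

lemma L_in_var_ideal_iff:
  assumes S: "S \<subseteq> {1..n}"
  shows "(L :: 'k::field mpoly) \<in> var_ideal n S \<longleftrightarrow> card S \<ge> 4"
proof -
  have fin: "finite S" using S finite_subset by blast
  have "(L :: 'k mpoly) \<in> var_ideal n S \<longleftrightarrow> (\<exists>x\<in>quadruples. (quad_sum x :: 'k mpoly) \<in> var_ideal n S)"
    unfolding L_def
    using prod_in_var_ideal_iff[OF fin finite_quadruples, of quad_sum] quad_sum_carrier by blast
  also have "\<dots> \<longleftrightarrow> card S \<ge> 4"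
  proof
    assume "\<exists>x\<in>quadruples. (quad_sum x :: 'k mpoly) \<in> var_ideal n S"
    then obtain a b c d where q: "(a, b, c, d) \<in> quadruples" "(quad_sum (a, b, c, d) :: 'k mpoly) \<in> var_ideal n S"
      by auto
    then have "{a, b, c, d} \<subseteq> S" using quad_sum_in_var_ideal_iff by blast
    moreover have "card {a, b, c, d} = 4" using q(1) by (auto simp: quadruples_def)
    ultimately show "card S \<ge> 4" using card_mono[OF fin] by metis
  next
    assume "card S \<ge> 4"
    with fin obtain a b c d where q: "{a, b, c, d} \<subseteq> S" "a < b" "b < c" "c < d"
      by (rule four_increasing)
    then have "(a, b, c, d) \<in> quadruples" using S by (auto simp: quadruples_def)
    then show "\<exists>x\<in>quadruples. (quad_sum x :: 'k mpoly) \<in> var_ideal n S"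
      using quad_sum_in_var_ideal_iff q(1) by blast
  qed
  finally show ?thesis .
qed

text \<open>The prime of an odd cycle is associated: the witness is the monomial with exponent \<open>1\<close> on the cycle and \<open>2\<close> at
all other vertices. It violates only the condition of \<open>C\<close>, and any variable of \<open>C\<close> repairs that.\<close>

lemma annihilator_of_cycle_prime:
  assumes C: "C \<in> odd_cycles"
  obtains r where "r \<in> carrier (poly_ring n)" "r \<notin> (Q :: 'k::field mpoly set)"
    "\<And>p. p \<in> var_ideal n C \<Longrightarrow> r * p \<in> Q"
proof -
  define w where "w = incidence {1..n} + incidence ({1..n} - C)"
  have w: "lookup w i = (if i \<in> {1..n} then if i \<in> C then 1 else 2 else 0)" for i
    by (simp add: w_def lookup_add lookup_incidence)
  have sub: "C \<subseteq> {1..n}" by (rule odd_cycle_subset[OF C])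
  have kw: "keys w \<subseteq> {1..n}" by (auto simp: w_def keys_add_nat keys_incidence)
  show ?thesis
  proof
    show "(monomial w :: 'k mpoly) \<in> carrier (poly_ring n)" using kw by (simp add: carrier_poly_ring)
    have "\<not> component_cond C w"
      using sub odd_cycle_card(1)[OF C] by (auto simp: component_cond_not_edge w)
    then show "(monomial w :: 'k mpoly) \<notin> Q" using C by (auto simp: Q_def)
    fix p :: "'k mpoly" assume p: "p \<in> var_ideal n C"
    show "monomial w * p \<in> Q"
      unfolding Q_def mono_ideal_def
    proof (intro CollectI ballI conjI)
      fix u assume "u \<in> keys (monomial w * p)"
      then obtain v where v: "v \<in> keys p" "u = w + v" by (auto elim!: in_keys_multE)
      then obtain i where i: "i \<in> C" "lookup v i \<noteq> 0" and kv: "keys v \<subseteq> {1..n}"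
        using p by (auto simp: var_ideal_def mono_ideal_def)
      show "keys u \<subseteq> {1..n}" using kw kv by (simp add: v keys_add_nat)
      fix S assume "S \<in> E \<union> odd_cycles"
      then show "component_cond S u"
      proof
        assume S: "S \<in> E"
        then obtain x y where xy: "S = {x, y}" "x \<noteq> y" by (rule edgeE)
        then have "x \<in> {1..n}" "y \<in> {1..n}" using edge_subset[OF S] by auto
        then show ?thesis using xy by (simp add: component_cond_edge v lookup_add w)
      next
        assume S: "S \<in> odd_cycles"
        have "\<exists>j\<in>S. lookup u j \<ge> 2"
        proof (cases "S \<subseteq> C")
          case True
          then have "S = C" using odd_cycle_subset_odd_cycle_eq C S by blast
          then show ?thesis using i sub by (intro bexI[of _ i]) (auto simp: v lookup_add w)
        next
          case False
          then obtain j where "j \<in> S" "j \<notin> C" by blast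
          then show ?thesis using odd_cycle_subset[OF S] by (intro bexI[of _ j]) (auto simp: v lookup_add w)
        qed
        then show ?thesis using odd_cycle_card(1)[OF S] by (simp add: component_cond_not_edge)
      qed
    qed
  qed
qed

text \<open>Without odd holes, \<open>L\<close> lies in none of the radicals of the components, hence can be cancelled in each of
them. If there is an odd hole \<open>C\<close>, then \<open>L\<close> lies in its prime and multiplies the witness above into \<open>J\<^sup>2\<close>.\<close>

theorem colon_iff_no_odd_hole:
  "ideal_colon (poly_ring n) (J \<cdot>\<^bsub>poly_ring n\<^esub> J) (PIdl\<^bsub>poly_ring n\<^esub> L) = (J \<cdot>\<^bsub>poly_ring n\<^esub> J :: 'k::field mpoly set)
    \<longleftrightarrow> (\<nexists>S. odd_hole {1..n} E S)"
proof -
  let ?R = "poly_ring n :: 'k mpoly ring"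
  interpret R: cring ?R by (rule cring_poly_ring)
  interpret Q: ideal "Q :: 'k mpoly set" ?R by (rule ideal_Q)
  have colon: "r \<in> ideal_colon ?R Q (PIdl\<^bsub>?R\<^esub> L) \<longleftrightarrow> r \<in> carrier ?R \<and> L * r \<in> Q" for r :: "'k mpoly"
  proof
    assume r: "r \<in> ideal_colon ?R Q (PIdl\<^bsub>?R\<^esub> L)"
    have "L \<in> PIdl\<^bsub>?R\<^esub> L" by (rule R.cgenideal_self[OF L_carrier])
    then show "r \<in> carrier ?R \<and> L * r \<in> Q" using r by (auto simp: ideal_colon_def mult.commute)
  next
    assume r: "r \<in> carrier ?R \<and> L * r \<in> Q"
    have "r * (x * L) \<in> Q" if "x \<in> carrier ?R" for x
      using Q.I_l_closed[of "L * r" x] r that by (simp add: ac_simps)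
    then show "r \<in> ideal_colon ?R Q (PIdl\<^bsub>?R\<^esub> L)"
      using r by (auto simp: ideal_colon_def cgenideal_def)
  qed
  show ?thesis
    unfolding J_squared
  proof
    assume eq: "ideal_colon ?R Q (PIdl\<^bsub>?R\<^esub> L) = Q"
    show "\<nexists>S. odd_hole {1..n} E S"
    proof
      assume "\<exists>S. odd_hole {1..n} E S"
      then obtain C where C: "C \<in> odd_cycles" "card C \<ge> 5" by (auto simp: odd_hole_def odd_cycles_def)
      obtain r where r: "r \<in> carrier ?R" "r \<notin> Q" "\<And>p. p \<in> var_ideal n C \<Longrightarrow> r * p \<in> Q"
        using annihilator_of_cycle_prime[OF C(1)] by blast
      have "(L :: 'k mpoly) \<in> var_ideal n C"
        using L_in_var_ideal_iff[OF odd_cycle_subset[OF C(1)]] C(2) by simp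
      then have "L * r \<in> Q" using r(3)[of L] by (simp add: mult.commute)
      then show False using colon r eq by blast
    qed
  next
    assume none: "\<nexists>S. odd_hole {1..n} E S"
    show "ideal_colon ?R Q (PIdl\<^bsub>?R\<^esub> L) = Q"
    proof (intro equalityI subsetI)
      fix r assume "r \<in> ideal_colon ?R Q (PIdl\<^bsub>?R\<^esub> L)"
      then have r: "r \<in> carrier ?R" "L * r \<in> Q" using colon by auto
      have "r \<in> mono_ideal n (\<lambda>u. \<forall>S\<in>E \<union> odd_cycles. True \<longrightarrow> component_cond S u)"
      proof (rule mem_mono_ideal_Ball[OF r(1)])
        fix S assume S: "S \<in> E \<union> odd_cycles"
        have "card S < 4"
        proof (cases "S \<in> E")
          case False
          then have "induced_cycle {1..n} E S" "odd (card S)" using S by (auto simp: odd_cycles_def)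
          then have "card S < 5" "card S \<noteq> 4" using none by (auto simp: odd_hole_def)
          then show ?thesis by linarith
        qed (simp add: edge_card)
        then have "(L :: 'k mpoly) \<notin> var_ideal n S" using L_in_var_ideal_iff[OF F[OF S]] by simp
        then show "r \<in> mono_ideal n (component_cond S)"
          using component_cancel[OF S r(1) L_carrier] r(2) Q_subset_component[OF S] by blast
      qed
      then show "r \<in> Q" by (simp add: Q_def)
    next
      fix r assume r: "r \<in> (Q :: 'k mpoly set)"
      then have "L * r \<in> Q" using Q.I_l_closed[OF r L_carrier] by simp
      then show "r \<in> ideal_colon ?R Q (PIdl\<^bsub>?R\<^esub> L)" using colon Q.Icarr[OF r] by blast
    qed
  qed
qed

end

theorem theorem1p2:
  fixes n :: nat and E :: "nat set set"
    and R :: "'k::field mpoly ring" and J :: "'k mpoly set" and L :: "'k mpoly"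
  assumes "simple_graph {1..n} E"
    and "R = poly_ring n"
    and "J = alexander_dual n (edge_ideal n E)"
    and "L = (\<Prod>(i\<^sub>1, i\<^sub>2, i\<^sub>3, i\<^sub>4) \<in> {(i\<^sub>1, i\<^sub>2, i\<^sub>3, i\<^sub>4). 1 \<le> i\<^sub>1 \<and> i\<^sub>1 < i\<^sub>2 \<and> i\<^sub>2 < i\<^sub>3 \<and> i\<^sub>3 < i\<^sub>4 \<and> i\<^sub>4 \<le> n}.
                 var i\<^sub>1 + var i\<^sub>2 + var i\<^sub>3 + var i\<^sub>4)"
  shows "((\<nexists>S. odd_hole {1..n} E S) \<longleftrightarrow>
            ideal_colon R (J \<cdot>\<^bsub>R\<^esub> J) (PIdl\<^bsub>R\<^esub> L) = J \<cdot>\<^bsub>R\<^esub> J)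
       \<and> (ideal_colon R (J \<cdot>\<^bsub>R\<^esub> J) (PIdl\<^bsub>R\<^esub> L) = J \<cdot>\<^bsub>R\<^esub> J \<longleftrightarrow>
            adeg n (J \<cdot>\<^bsub>R\<^esub> J) = of_nat (3 * card E + num_triangles {1..n} E))"
proof -
  interpret G: nat_graph n E
    by (intro nat_graph.intro graph.intro assms(1))
  have J: "J = G.J" by (simp add: assms(3) G.J_def)
  have L: "L = G.L" by (simp add: assms(4) G.L_def G.quad_sum_def G.quadruples_def)
  show ?thesis
    unfolding assms(2) J L using G.colon_iff_no_odd_hole G.adeg_iff_no_odd_hole by blast
qed

end
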